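(* Fix $p\ge2$ and $c=(c_1,\dots,c_k)\in\mathbb R^k$ with $\sum_{j=1}^k c_j=1$. The following are equivalent. (i) $c_j\ge0$ for every $j$. (ii) For every collection of nonzero vectors $a_1,\dots,a_k\in\mathbb R^p$, the field $g_{a,c}(u):=\sum_{j=1}^k c_j\frac{a_j}{a_j^\top u}$ satisfies $$\frac1{\|g_{a,c}(U)\|^2}\sim\mathrm{Beta}\Bigl(\tfrac12,\tfrac{p-1}2\Bigr),$$ where $U$ is uniformly distributed on $\mathbb S^{p-1}$. (iii) For every $\alpha_1,\dots,\alpha_k\in\mathbb R$ and $\Phi$ uniformly distributed on $\mathbb R/(\pi\mathbb Z)$, $$\sum_{j=1}^k c_j\tan(\Phi-\alpha_j)\sim\mathrm{Cauchy}(0,1).$$ Thus, after the normalization $\sum_j c_j=1$, the probability simplex is exactly the maximal real coefficient class for which either universality holds over every arrangement.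
   Context: The field $g_{a,c}$ is defined for $u\in\mathbb S^{p-1}$ off the Haar-null set where some $a_j^\top u=0$; there $u^\top g_{a,c}(u)=1$, so $g_{a,c}(u)\neq0$. $\mathrm{Cauchy}(0,1)$ is the standard Cauchy law. *)

theory Defs
  imports "HOL-Probability.Probability"
begin

(* Uniform law on the unit sphere, as the normalized cone measure: the law of x / |x| for x
   uniform in the unit ball. It is carried as a Borel measure on the ambient space; the lemmas
   below show that it is a rotation-invariant probability measure concentrated on the sphere,
   properties that determine the normalized surface (Haar) measure. *)
definition uniform_sphere :: "'a::euclidean_space measure" where
  "uniform_sphere = distr (uniform_measure lborel (ball 0 1)) borel (\<lambda>x. x /\<^sub>R norm x)"

(* The representatives {0..<pi} stand for R/(pi Z): only pi-periodic functions are evaluated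
   against this law. *)
definition uniform_circle_pi :: "real measure" where
  "uniform_circle_pi = uniform_measure lborel {0..<pi}"

definition beta_density :: "real \<Rightarrow> real \<Rightarrow> real \<Rightarrow> real" where
  "beta_density \<alpha> \<beta> x =
     (if 0 < x \<and> x < 1 then x powr (\<alpha> - 1) * (1 - x) powr (\<beta> - 1) / Beta \<alpha> \<beta> else 0)"

definition cauchy_density :: "real \<Rightarrow> real \<Rightarrow> real \<Rightarrow> real" where
  "cauchy_density x\<^sub>0 \<gamma> x = 1 / (pi * \<gamma> * (1 + ((x - x\<^sub>0) / \<gamma>)\<^sup>2))"

(* On the null set where some a j \<bullet> u vanishes, division by zero yields 0, so the
   corresponding summand drops out; this does not affect laws under uniform_sphere. *)
definition hyperplane_field :: "('k::finite \<Rightarrow> real^'p) \<Rightarrow> real^'k \<Rightarrow> real^'p \<Rightarrow> real^'p" where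
  "hyperplane_field a c u = (\<Sum>j\<in>UNIV. (c $ j) *\<^sub>R (a j /\<^sub>R (a j \<bullet> u)))"

(* The type argument 'p fixes the dimension p = CARD('p) of the ambient space. *)
definition beta_universal :: "'p::finite itself \<Rightarrow> real^'k::finite \<Rightarrow> bool" where
  "beta_universal _ c \<longleftrightarrow>
     (\<forall>a :: 'k \<Rightarrow> real^'p. (\<forall>j. a j \<noteq> 0) \<longrightarrow>
        distributed uniform_sphere lborel
          (\<lambda>u. 1 / (norm (hyperplane_field a c u))\<^sup>2)
          (\<lambda>x. ennreal (beta_density (1 / 2) ((real CARD('p) - 1) / 2) x)))"

definition cauchy_universal :: "real^'k::finite \<Rightarrow> bool" where
  "cauchy_universal c \<longleftrightarrow>
     (\<forall>\<alpha> :: 'k \<Rightarrow> real.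
        distributed uniform_circle_pi lborel
          (\<lambda>\<phi>. \<Sum>j\<in>UNIV. c $ j * tan (\<phi> - \<alpha> j))
          (\<lambda>x. ennreal (cauchy_density 0 1 x)))"

definition probability_simplex :: "(real^'k::finite) set" where
  "probability_simplex = {c. (\<forall>j. 0 \<le> c $ j) \<and> (\<Sum>j\<in>UNIV. c $ j) = 1}"

lemma sets_uniform_sphere [simp, measurable_cong]: "sets uniform_sphere = sets borel"
  by (simp add: uniform_sphere_def)

lemma emeasure_unit_ball_pos_finite:
  "emeasure lborel (ball (0::'a::euclidean_space) 1) \<noteq> 0"
  "emeasure lborel (ball (0::'a::euclidean_space) 1) \<noteq> \<infinity>"
proof -
  have "unit_ball_vol (real DIM('a)) > 0"
    by (rule unit_ball_vol_pos) simp
  from less_imp_neq[OF this, symmetric] show "emeasure lborel (ball (0::'a) 1) \<noteq> 0"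
    by (simp add: emeasure_ball)
qed (use emeasure_lborel_ball_finite[of "0::'a" 1] in auto)

lemma prob_space_uniform_sphere: "prob_space uniform_sphere"
  unfolding uniform_sphere_def
  by (intro prob_space.prob_space_distr prob_space_uniform_measure
      emeasure_unit_ball_pos_finite) measurable

lemma AE_uniform_sphere:
  "AE u in (uniform_sphere :: 'a::euclidean_space measure). u \<in> sphere 0 1"
proof -
  have "AE x in lborel. x \<noteq> (0::'a)"
    by (rule AE_lborel_singleton)
  then have "AE x in uniform_measure lborel (ball (0::'a) 1). x \<noteq> 0"
    by (intro AE_uniform_measureI) auto
  then show ?thesis
    unfolding uniform_sphere_def
    by (subst AE_distr_iff) (auto simp: borel_closed)
qed

lemma orthogonal_lborel_open_le:
  fixes T :: "'a::euclidean_space \<Rightarrow> 'a"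
  assumes T: "orthogonal_transformation T" and U: "open U"
  shows "emeasure lborel U \<le> emeasure lborel (T -` U)"
proof -
  have lin: "linear T" and surj: "surj T"
    using T by (auto simp: orthogonal_transformation_linear orthogonal_transformation_surj)
  have [measurable]: "T \<in> borel_measurable borel"
    by (intro borel_measurable_continuous_onI linear_continuous_on linear_conv_bounded_linear[THEN iffD1] lin)
  define K where "K = {i. 0 < snd i \<and> ball (fst i) (snd i) \<subseteq> U}"
  have "\<exists>i. i \<in> K \<and> x \<in> ball (fst i) (snd i) \<and> snd i < d" if "x \<in> U" "0 < d" for x d
  proof -
    obtain e where e: "e > 0" "ball x e \<subseteq> U"
      using openE[OF U \<open>x \<in> U\<close>] by metis
    have "ball x (min e (d/2)) \<subseteq> ball x e"
      by (rule subset_ball) simp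
    with e have "(x, min e (d/2)) \<in> K"
      using \<open>0 < d\<close> by (simp add: K_def)
    moreover have "x \<in> ball x (min e (d/2))" "min e (d/2) < d"
      using e(1) \<open>0 < d\<close> by simp_all
    ultimately show ?thesis
      by (metis fst_conv snd_conv)
  qed
  then obtain C where C: "countable C" "C \<subseteq> K"
     "pairwise (\<lambda>i j. disjnt (ball (fst i) (snd i)) (ball (fst j) (snd j))) C"
     "negligible (U - (\<Union>i \<in> C. ball (fst i) (snd i)))"
    by (rule Vitali_covering_theorem_balls[of U K fst snd])
  let ?B = "\<lambda>i::'a \<times> real. ball (fst i) (snd i)"
  let ?V = "\<Union>i\<in>C. ?B i"
  have V: "?V \<subseteq> U" "open ?V"
    using C(2) unfolding K_def by blast+
  have disj: "disjoint_family_on ?B C"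
    using C(3) by (auto simp: disjoint_family_on_def pairwise_def disjnt_def)
  then have disjT: "disjoint_family_on (\<lambda>i. T -` ?B i) C"
    by (fastforce simp: disjoint_family_on_def)
  have ball: "emeasure lborel (T -` ball x r) = emeasure lborel (ball x r)" if "r > 0" for x r
  proof -
    obtain y where y: "T y = x"
      using surj by (metis surjD)
    have "T -` ball x r = ball y r"
      using T by (auto simp: y[symmetric] dist_norm orthogonal_transformation_norm
          simp flip: linear_diff[OF lin])
    then show ?thesis
      using that by (simp add: emeasure_ball)
  qed
  have "U - ?V \<in> null_sets lborel"
    using C(4) U V by (auto simp: negligible_iff_null_sets null_sets_completion_iff)
  then have "emeasure lborel U = emeasure lborel (U - (U - ?V))"
    using U by (intro emeasure_Diff_null_set[symmetric]) auto
  also have "U - (U - ?V) = ?V"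
    using V by blast
  also have "emeasure lborel ?V = (\<integral>\<^sup>+i. emeasure lborel (?B i) \<partial>count_space C)"
    by (intro emeasure_UN_countable C disj) auto
  also have "\<dots> = (\<integral>\<^sup>+i. emeasure lborel (T -` ?B i) \<partial>count_space C)"
    using C(2) by (intro nn_integral_cong) (auto simp: K_def ball)
  also have "\<dots> = emeasure lborel (\<Union>i\<in>C. T -` ?B i)"
    using measurable_sets[of T borel borel]
    by (intro emeasure_UN_countable[symmetric] C disjT) auto
  also have "\<dots> \<le> emeasure lborel (T -` U)"
    using V(1) U measurable_sets[of T borel borel] by (intro emeasure_mono) auto
  finally show ?thesis .
qed

lemma distr_lborel_orthogonal:
  fixes T :: "'a::euclidean_space \<Rightarrow> 'a"
  assumes T: "orthogonal_transformation T"
  shows "distr lborel borel T = lborel"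
proof (rule lborel_eqI[symmetric])
  have lin: "linear T"
    using T by (auto simp: orthogonal_transformation_linear)
  have cont: "continuous_on UNIV T"
    by (intro linear_continuous_on linear_conv_bounded_linear[THEN iffD1] lin)
  have [measurable]: "T \<in> borel_measurable borel"
    by (intro borel_measurable_continuous_onI cont)
  fix l u :: 'a
  assume le: "\<And>b. b \<in> Basis \<Longrightarrow> l \<bullet> b \<le> u \<bullet> b"
  have op: "open (T -` box l u)"
    by (intro open_vimage cont) auto
  have "T \<circ> inv T = id"
    using orthogonal_transformation_surj[OF T] by (simp add: surj_iff)
  then have eq: "inv T -` (T -` box l u) = box l u"
    unfolding vimage_comp by simp
  have "emeasure lborel (T -` box l u) \<le> emeasure lborel (box l u)"
    using orthogonal_lborel_open_le[OF orthogonal_transformation_inv[OF T] op] unfolding eq .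
  moreover have "emeasure lborel (box l u) \<le> emeasure lborel (T -` box l u)"
    by (rule orthogonal_lborel_open_le[OF T open_box])
  ultimately have "emeasure lborel (T -` box l u) = emeasure lborel (box l u)"
    by (rule antisym)
  then show "emeasure (distr lborel borel T) (box l u) = (\<Prod>b\<in>Basis. (u - l) \<bullet> b)"
    using le by (simp add: emeasure_distr emeasure_lborel_box)
qed simp

lemma uniform_sphere_orthogonal:
  fixes T :: "'a::euclidean_space \<Rightarrow> 'a"
  assumes T: "orthogonal_transformation T"
  shows "distr uniform_sphere borel T = uniform_sphere"
proof -
  let ?B = "ball (0::'a) 1"
  let ?U = "uniform_measure lborel ?B"
  have lin: "linear T"
    using T by (auto simp: orthogonal_transformation_linear)
  have mT [measurable]: "T \<in> borel_measurable borel"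
    by (intro borel_measurable_continuous_onI linear_continuous_on linear_conv_bounded_linear[THEN iffD1] lin)
  have norm: "norm (T x) = norm x" for x
    using T by (rule orthogonal_transformation_norm)
  have U: "distr ?U borel T = ?U"
  proof (rule measure_eqI)
    fix A assume "A \<in> sets (distr ?U borel T)"
    then have [measurable]: "A \<in> sets borel"
      by simp
    have TA: "T -` A \<in> sets borel"
      using measurable_sets[OF mT, of A] by simp
    have "emeasure (distr ?U borel T) A = emeasure lborel (?B \<inter> T -` A) / emeasure lborel ?B"
      using TA by (simp add: emeasure_distr)
    also have "?B \<inter> T -` A = T -` (?B \<inter> A)"
      by (auto simp: norm)
    also have "emeasure lborel (T -` (?B \<inter> A)) = emeasure (distr lborel borel T) (?B \<inter> A)"
      by (simp add: emeasure_distr)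
    also have "\<dots> = emeasure lborel (?B \<inter> A)"
      by (simp add: distr_lborel_orthogonal[OF T])
    finally show "emeasure (distr ?U borel T) A = emeasure ?U A"
      by simp
  qed simp
  have "distr uniform_sphere borel T = distr ?U borel (\<lambda>x. T (x /\<^sub>R norm x))"
    unfolding uniform_sphere_def by (subst distr_distr) (auto simp: o_def)
  also have "(\<lambda>x. T (x /\<^sub>R norm x)) = (\<lambda>x. T x /\<^sub>R norm (T x))"
    by (simp add: linear_scale[OF lin] norm)
  also have "distr ?U borel (\<lambda>x. T x /\<^sub>R norm (T x)) =
      distr (distr ?U borel T) borel (\<lambda>x. x /\<^sub>R norm x)"
    by (subst distr_distr) (auto simp: o_def)
  also have "\<dots> = uniform_sphere"
    unfolding U uniform_sphere_def ..
  finally show ?thesis .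
qed

end

theory Submission
  imports Defs "HOL-Complex_Analysis.Cauchy_Integral_Formula"
begin

text \<open>
  Nonnegative coefficients give the Cauchy law because the tangent is the boundary value of a
  holomorphic map from the disc to the upper half plane. With \<open>w = e\<^sup>2\<^sup>i\<^sup>\<phi>\<close> one has
  \<open>tan \<phi> = i (1 - w) / (1 + w)\<close>, so \<open>\<Sum> c\<^sub>j tan (\<phi> - \<alpha>\<^sub>j)\<close> is the boundary value of a map \<open>G\<close> on the
  disc with \<open>G(0) = i \<Sum> c\<^sub>j = i\<close>, and \<open>Im G \<ge> 0\<close> because \<open>c\<^sub>j \<ge> 0\<close>. For \<open>s \<ge> 0\<close> the function
  \<open>exp (i s G)\<close> is therefore bounded by 1, and the mean value property gives the characteristic
  function \<open>exp (i s G(0)) = e\<^sup>-\<^sup>s\<close>, whatever the angles are (\<open>char_tan_combination\<close>). The standard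
  Cauchy law is the law of the tangent of a uniform angle, so it has the same characteristic function.

  The Beta law is reduced to this computation. Let \<open>X\<close>, \<open>Y\<close> be independent Gaussian vectors and \<open>g\<close>
  the field. Then \<open>g(X) \<bullet> Y = \<Sum> c\<^sub>j (a\<^sub>j \<bullet> Y) / (a\<^sub>j \<bullet> X)\<close>, and rotating the pair \<open>(X, Y)\<close> by an
  angle \<open>\<phi>\<close>, which preserves its law, turns the quotients into \<open>tan (\<phi> - \<theta>\<^sub>j)\<close>. Averaging over \<open>\<phi>\<close>
  gives \<open>E exp (i s g(X) \<bullet> Y) = e\<^sup>-\<^sup>s\<close>; integrating out \<open>Y\<close> first identifies the Laplace transform of
  \<open>\<parallel>g(X)\<parallel>\<^sup>2\<close> (\<open>gaussian_transform_field\<close>). A Mellin integral in \<open>s\<close> converts it into the moments of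
  \<open>1 / \<parallel>g(X)\<parallel>\<^sup>2\<close> (\<open>gaussian_moments_field\<close>). As \<open>g\<close> is homogeneous of degree -1, this variable is
  \<open>\<parallel>X\<parallel>\<^sup>2\<close> times \<open>1 / \<parallel>g(U)\<parallel>\<^sup>2\<close> for the direction \<open>U\<close> of \<open>X\<close>, which is uniform and independent of
  \<open>\<parallel>X\<parallel>\<close> (\<open>gaussian_polar\<close>). Dividing the moments yields those of the Beta law. Since
  \<open>g(U) \<bullet> U = 1\<close>, the variable \<open>1 / \<parallel>g(U)\<parallel>\<^sup>2\<close> lives in \<open>[0, 1]\<close>, where moments determine the law
  (\<open>real_distribution_eqI_moments\<close>).

  Conversely, let the negative coefficients have sum \<open>- m < 0\<close>, so the others have sum \<open>1 + m\<close>. Giving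
  one angle (or one vector) to each of the two groups, at right angles to each other, produces
  \<open>(1 + m) tan \<phi> + m cot \<phi>\<close>, which avoids a neighbourhood of 0, or a field of norm at least
  \<open>1 + m\<close>, whose inverse square avoids the interval between \<open>1 / (1 + m)\<^sup>2\<close> and 1. The Cauchy and
  Beta densities are positive there.
\<close>

section \<open>The characteristic function of a sum of tangents\<close>

text \<open>At the poles of the tangent both sides are 0 by the convention for division by zero, so the
  identity holds for every \<open>x\<close>.\<close>
lemma tan_eq_cayley: "complex_of_real (tan x) = \<i> * (1 - cis (2 * x)) / (1 + cis (2 * x))"
proof -
  have p: "1 + cis (2 * x) = 2 * complex_of_real (cos x) * cis x"
    by (rule complex_eqI) (simp_all add: cos_double_cos sin_double power2_eq_square)
  have m: "1 - cis (2 * x) = - 2 * \<i> * complex_of_real (sin x) * cis x"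
    by (rule complex_eqI) (simp_all add: cos_double_sin sin_double power2_eq_square)
  show ?thesis
    unfolding p m by (cases "cos x = 0") (simp_all add: tan_def field_simps)
qed

text \<open>The sum of tangents, continued to the unit disc: the boundary point \<open>cis (2 * \<phi>)\<close> carries the
  value at the angle \<open>\<phi>\<close>, so a half turn of \<open>\<phi>\<close> runs once around the circle.\<close>
definition disc_map :: "real^'k::finite \<Rightarrow> ('k \<Rightarrow> real) \<Rightarrow> complex \<Rightarrow> complex" where
  "disc_map c \<alpha> w =
     (\<Sum>j\<in>UNIV. complex_of_real (c $ j) *
        (\<i> * (1 - w * cis (- 2 * \<alpha> j)) / (1 + w * cis (- 2 * \<alpha> j))))"

lemma disc_map_boundary:
  "disc_map c \<alpha> (cis (2 * \<phi>)) = complex_of_real (\<Sum>j\<in>UNIV. c $ j * tan (\<phi> - \<alpha> j))"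
  by (simp add: disc_map_def tan_eq_cayley cis_mult algebra_simps)

lemma Re_cayley: "Re ((1 - z) / (1 + z)) = (1 - (cmod z)\<^sup>2) / (cmod (1 + z))\<^sup>2"
proof -
  have "Re ((1 - z) / (1 + z)) = ((1 - Re z) * (1 + Re z) - Im z * Im z) / (cmod (1 + z))\<^sup>2"
    by (simp add: Re_divide')
  also have "(1 - Re z) * (1 + Re z) - Im z * Im z = 1 - (cmod z)\<^sup>2"
    by (simp add: cmod_power2) (simp add: power2_eq_square algebra_simps)
  finally show ?thesis .
qed

text \<open>The Cayley map sends the closed disc to the closed upper half plane, a convex cone, which is
  where the sign of the coefficients enters.\<close>
lemma Im_disc_map_nonneg:
  assumes c: "\<And>j. 0 \<le> c $ j" and w: "cmod w \<le> 1"
  shows "0 \<le> Im (disc_map c \<alpha> w)"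
proof -
  have "Im (\<i> * (1 - w * cis t) / (1 + w * cis t)) \<ge> 0" for t
  proof -
    have "Im (\<i> * (1 - w * cis t) / (1 + w * cis t)) = Re ((1 - w * cis t) / (1 + w * cis t))"
      by (metis Im_i_times times_divide_eq_right)
    also have "\<dots> \<ge> 0"
      unfolding Re_cayley using w by (auto simp: norm_mult power_le_one intro!: divide_nonneg_nonneg)
    finally show ?thesis .
  qed
  moreover have "0 \<le> Im (complex_of_real (c $ j) * z)" if "0 \<le> Im z" for j z
    using that c by simp
  ultimately show ?thesis
    unfolding disc_map_def Im_sum by (intro sum_nonneg) blast
qed

lemma one_plus_cis_nonzero: "cmod w < 1 \<Longrightarrow> 1 + w * cis t \<noteq> 0"
  by (metis add_eq_0_iff less_irrefl mult.right_neutral norm_cis norm_minus_cancel norm_mult norm_one)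

lemma holomorphic_disc_map: "disc_map c \<alpha> holomorphic_on ball 0 1"
  unfolding disc_map_def
  by (intro holomorphic_intros) (auto simp: one_plus_cis_nonzero)

lemma prob_space_uniform_circle_pi: "prob_space uniform_circle_pi"
  unfolding uniform_circle_pi_def by (rule prob_space_uniform_measure) auto

lemma sets_uniform_circle_pi [simp, measurable_cong]: "sets uniform_circle_pi = sets borel"
  by (simp add: uniform_circle_pi_def)

lemma space_uniform_circle_pi [simp]: "space uniform_circle_pi = UNIV"
  by (simp add: uniform_circle_pi_def)

lemma integral_uniform_circle_pi:
  fixes f :: "real \<Rightarrow> complex"
  assumes [measurable]: "f \<in> borel_measurable borel"
  shows "integral\<^sup>L uniform_circle_pi f = (LINT x:{0..pi}|lborel. f x) / pi"
proof -
  have eq: "uniform_circle_pi = density lborel (\<lambda>x. ennreal (indicator {0..<pi} x / pi))"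
    unfolding uniform_circle_pi_def uniform_measure_def
    by (intro density_cong) (auto simp: divide_ennreal indicator_def divide_ennreal_def ennreal_inverse_1 inverse_ennreal inverse_eq_divide split: split_indicator)
  have "integral\<^sup>L uniform_circle_pi f = (LINT x|lborel. (indicator {0..<pi} x / pi) *\<^sub>R f x)"
    unfolding eq by (rule integral_density) auto
  also have "\<dots> = (LINT x|lborel. (indicator {0..pi} x *\<^sub>R f x) / pi)"
    by (intro integral_cong_AE)
       (auto intro!: eventually_mono[OF AE_lborel_singleton[of pi]] simp: indicator_def scaleR_conv_of_real)
  finally show ?thesis
    by (simp add: set_lebesgue_integral_def)
qed

lemma AE_uniform_circle_pi_cos:
  "AE \<phi> in uniform_circle_pi. \<forall>j::'k::finite. cos (\<phi> - \<alpha> j) \<noteq> 0"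
proof -
  have "AE \<phi> in uniform_circle_pi. cos (\<phi> - a) \<noteq> 0" for a
  proof -
    have "{\<phi>. cos (\<phi> - a) = 0} \<subseteq> range (\<lambda>i::int. of_int i * (pi/2) + a)"
    proof
      fix \<phi> assume "\<phi> \<in> {\<phi>. cos (\<phi> - a) = 0}"
      then obtain i :: int where "\<phi> - a = of_int i * (pi/2)"
        by (auto simp: cos_zero_iff_int)
      then have "\<phi> = of_int i * (pi/2) + a" by simp
      then show "\<phi> \<in> range (\<lambda>i::int. of_int i * (pi/2) + a)" by (rule range_eqI)
    qed
    then have "countable {\<phi>. cos (\<phi> - a) = 0}"
      by (rule countable_subset) simp
    then have "{\<phi>. cos (\<phi> - a) = 0} \<in> null_sets lborel"
      by (rule countable_imp_null_set_lborel)
    then have "AE \<phi> in lborel. cos (\<phi> - a) \<noteq> 0"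
      by (rule AE_I') auto
    then show ?thesis
      unfolding uniform_circle_pi_def by (intro AE_uniform_measureI) auto
  qed
  then show ?thesis by (rule eventually_all_finite)
qed

text \<open>Cauchy's integral formula at the centre; the factor 2 lets the angles in \<open>[0, \<pi>)\<close> cover the circle
  once.\<close>
lemma mean_value_disc:
  fixes h :: "complex \<Rightarrow> complex"
  assumes h: "h holomorphic_on ball 0 1" and r: "0 < r" "r < 1"
  shows "(\<integral>\<phi>. h (of_real r * cis (2 * \<phi>)) \<partial>uniform_circle_pi) = h 0"
proof -
  have sub: "cball 0 r \<subseteq> ball (0::complex) 1" using r by auto
  have cont: "continuous_on UNIV (\<lambda>x. h (of_real r * cis (a * x)))" for a
    using r by (intro continuous_on_compose2[OF holomorphic_on_imp_continuous_on[OF h]] continuous_intros)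
      (auto simp: norm_mult)
  have "((\<lambda>u. h u / (u - 0)) has_contour_integral (2 * of_real pi * \<i> * h 0)) (circlepath 0 r)"
    by (rule Cauchy_integral_circlepath_simple) (use r holomorphic_on_subset[OF h sub] in auto)
  then have "((\<lambda>t. h (of_real r * cis t) / (of_real r * cis t) * of_real r * \<i> * cis t)
      has_integral (2 * of_real pi * \<i> * h 0)) {0..2*pi}"
    unfolding circlepath_def by (subst (asm) has_contour_integral_part_circlepath_iff) auto
  then have "((\<lambda>t. (- \<i>) * (h (of_real r * cis t) / (of_real r * cis t) * of_real r * \<i> * cis t))
      has_integral (- \<i>) * (2 * of_real pi * \<i> * h 0)) {0..2*pi}"
    by (rule has_integral_mult_right)
  also have "(\<lambda>t. (- \<i>) * (h (of_real r * cis t) / (of_real r * cis t) * of_real r * \<i> * cis t))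
     = (\<lambda>t. h (of_real r * cis t))"
    using r by (auto simp: field_simps)
  also have "(- \<i>) * (2 * of_real pi * \<i> * h 0) = 2 * of_real pi * h 0"
    by (simp add: algebra_simps)
  finally have "((\<lambda>t. h (of_real r * cis t)) has_integral (2 * of_real pi * h 0)) {0..2*pi}" .
  from has_integral_stretch_real[OF this, of 2]
  have "((\<lambda>t. h (of_real r * cis (2 * t))) has_integral (of_real pi * h 0)) {0..pi}"
    by (simp add: scaleR_conv_of_real image_divide_atLeastAtMost)
  moreover have "set_integrable lborel {0..pi} (\<lambda>t. h (of_real r * cis (2 * t)))"
    by (rule borel_integrable_compact[unfolded set_integrable_def[symmetric]])
       (auto intro: continuous_on_subset[OF cont])
  ultimately have "(LINT x:{0..pi}|lborel. h (of_real r * cis (2 * x))) = of_real pi * h 0"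
    by (metis integral_unique set_borel_integral_eq_integral(2))
  then show ?thesis
    using borel_measurable_continuous_onI[OF cont] by (simp add: integral_uniform_circle_pi)
qed

lemma borel_measurable_tan [measurable]: "(tan :: real \<Rightarrow> real) \<in> borel_measurable borel"
  unfolding tan_def[abs_def] by measurable

text \<open>The function \<open>exp (\<i> * s * G)\<close>, with \<open>G\<close> the continuation to the disc, is bounded by 1 there
  and equals \<open>exp (- s)\<close> at 0. It is singular on the boundary, so the mean value property is applied
  on smaller circles and the radius is sent to 1 by dominated convergence.\<close>
lemma char_tan_combination:
  fixes c :: "real^'k::finite"
  assumes c: "\<And>j. 0 \<le> c $ j" "(\<Sum>j\<in>UNIV. c $ j) = 1" and s: "0 \<le> s"
  shows "(\<integral>\<phi>. iexp (s * (\<Sum>j\<in>UNIV. c $ j * tan (\<phi> - \<alpha> j))) \<partial>uniform_circle_pi) = exp (- s)"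
proof -
  interpret prob_space uniform_circle_pi by (rule prob_space_uniform_circle_pi)
  define h where "h = (\<lambda>w. exp (\<i> * (of_real s * disc_map c \<alpha> w)))"
  \<comment> \<open>radii in (0, 1) that increase to 1\<close>
  define r where "r = (\<lambda>n::nat. 1 - 1 / (real n + 2))"
  have r: "0 < r n" "r n < 1" for n by (auto simp: r_def)
  have rlim: "r \<longlonglongrightarrow> 1"
    unfolding r_def by real_asymp
  have hol: "h holomorphic_on ball 0 1"
    unfolding h_def by (intro holomorphic_intros holomorphic_disc_map)
  have bd: "cmod (h w) \<le> 1" if "cmod w \<le> 1" for w
    using Im_disc_map_nonneg[OF c(1) that, of \<alpha>] s by (simp add: h_def)
  have "disc_map c \<alpha> 0 = \<i>"
    by (simp add: disc_map_def sum_distrib_right[symmetric] of_real_sum[symmetric] c(2) del: of_real_sum)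
  then have h0: "h 0 = exp (- s)"
    by (simp add: h_def exp_of_real[symmetric] mult.left_commute[of \<i> "complex_of_real s"])
  have cont: "continuous_on UNIV (\<lambda>x. h (of_real (r n) * cis (2 * x)))" for n
    using r[of n] by (intro continuous_on_compose2[OF holomorphic_on_imp_continuous_on[OF hol]] continuous_intros)
      (auto simp: norm_mult)
  have lim: "(\<lambda>n. h (of_real (r n) * cis (2 * \<phi>))) \<longlonglongrightarrow> h (cis (2 * \<phi>))"
    if nz: "\<forall>j. cos (\<phi> - \<alpha> j) \<noteq> 0" for \<phi>
  proof -
    have "(\<lambda>n. of_real (r n) * cis (2 * \<phi>)) \<longlonglongrightarrow> of_real 1 * cis (2 * \<phi>)"
      by (intro tendsto_intros rlim)
    then have wl: "(\<lambda>n. of_real (r n) * cis (2 * \<phi>)) \<longlonglongrightarrow> cis (2 * \<phi>)" by simp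
    have "1 + cis (2 * \<phi>) * cis (- 2 * \<alpha> j) \<noteq> 0" for j
    proof -
      have "cis (2 * \<phi>) * cis (- 2 * \<alpha> j) = cis (2 * (\<phi> - \<alpha> j))"
        by (simp add: cis_mult algebra_simps)
      moreover have "Re (1 + cis (2 * (\<phi> - \<alpha> j))) = 2 * (cos (\<phi> - \<alpha> j))\<^sup>2"
        by (simp only: plus_complex.sel one_complex.sel cis.sel cos_double_cos)
      ultimately show ?thesis using nz by (metis mult_eq_0_iff power_eq_0_iff zero_complex.sel(1) zero_neq_numeral)
    qed
    then show ?thesis
      unfolding h_def disc_map_def by (intro tendsto_intros wl)
  qed
  have "(\<lambda>n. \<integral>\<phi>. h (of_real (r n) * cis (2 * \<phi>)) \<partial>uniform_circle_pi)
     \<longlonglongrightarrow> (\<integral>\<phi>. h (cis (2 * \<phi>)) \<partial>uniform_circle_pi)"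
  proof (rule integral_dominated_convergence[where w = "\<lambda>_. 1"])
    show "(\<lambda>\<phi>. h (cis (2 * \<phi>))) \<in> borel_measurable uniform_circle_pi"
      unfolding h_def disc_map_boundary by measurable
    show "(\<lambda>\<phi>. h (of_real (r n) * cis (2 * \<phi>))) \<in> borel_measurable uniform_circle_pi" for n
      using borel_measurable_continuous_onI[OF cont[of n]] by (simp add: measurable_cong_sets[OF sets_uniform_circle_pi refl])
    show "AE \<phi> in uniform_circle_pi. (\<lambda>n. h (of_real (r n) * cis (2 * \<phi>))) \<longlonglongrightarrow> h (cis (2 * \<phi>))"
      using AE_uniform_circle_pi_cos[of \<alpha>] by eventually_elim (rule lim)
    show "AE \<phi> in uniform_circle_pi. cmod (h (of_real (r n) * cis (2 * \<phi>))) \<le> 1" for n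
      using r[of n] by (intro AE_I2 bd) (auto simp: norm_mult)
  qed auto
  then have "(\<integral>\<phi>. h (cis (2 * \<phi>)) \<partial>uniform_circle_pi) = exp (- s)"
    unfolding mean_value_disc[OF hol r] h0 LIMSEQ_const_iff by (rule sym)
  then show ?thesis
    by (simp add: h_def disc_map_boundary)
qed

section \<open>The Cauchy law\<close>

lemma cauchy_density_pos: "0 < cauchy_density 0 1 x"
  by (simp add: cauchy_density_def pi_gt_zero add_pos_nonneg)

lemma isCont_cauchy_density: "isCont (cauchy_density 0 1) x"
proof -
  have "pi * 1 * (1 + ((x - 0) / 1)\<^sup>2) \<noteq> 0"
    by (simp add: add_nonneg_eq_0_iff)
  then show ?thesis
    unfolding cauchy_density_def by (intro continuous_intros) auto
qed

lemma borel_measurable_cauchy_density [measurable]: "cauchy_density a b \<in> borel_measurable borel"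
  unfolding cauchy_density_def by measurable

text \<open>The derivative of the tangent cancels the Cauchy density: uniform angles have Cauchy tangents.\<close>
lemma cauchy_density_tan_jacobian:
  "(1 + (tan x)\<^sup>2) * cauchy_density 0 1 (tan x) = 1 / pi"
proof -
  have "1 + (tan x)\<^sup>2 > 0" by (simp add: add_pos_nonneg)
  then show ?thesis by (simp add: cauchy_density_def)
qed

lemma integral_cauchy_density:
  "integrable lborel (cauchy_density 0 1)" "(LINT x|lborel. cauchy_density 0 1 x) = 1"
proof -
  have eq: "cauchy_density 0 1 = (\<lambda>x. inverse (1 + x\<^sup>2) / pi)"
    by (auto simp: cauchy_density_def field_simps)
  show "integrable lborel (cauchy_density 0 1)"
    using integrable_inverse_1_plus_square unfolding eq by (simp add: set_integrable_def)
  show "(LINT x|lborel. cauchy_density 0 1 x) = 1"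
    using LBINT_inverse_1_plus_square unfolding eq
    by (simp add: interval_lebesgue_integral_def set_lebesgue_integral_def)
qed

lemma real_distribution_cauchy: "real_distribution (density lborel (cauchy_density 0 1))"
proof -
  have "prob_space (density lborel (cauchy_density 0 1))"
    by (rule prob_spaceI) (simp add: emeasure_density nn_integral_eq_integral integral_cauchy_density less_imp_le[OF cauchy_density_pos])
  then show ?thesis by (simp add: real_distribution_def real_distribution_axioms_def)
qed

text \<open>The tangent is monotone between consecutive poles, so the substitution takes place on
  \<open>(-\<pi>/2, \<pi>/2)\<close>; this moves the integral to the interval of representatives \<open>[0, \<pi>]\<close>.\<close>
lemma LINT_shift_half_pi:
  fixes f :: "real \<Rightarrow> complex"
  assumes [measurable]: "f \<in> borel_measurable borel"
  shows "(LINT x=ereal (- pi/2)..ereal (pi/2)|lborel. f x) = (LINT x:{0..pi}|lborel. f (x - pi/2))"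
proof -
  have "(LINT x=ereal (- pi/2)..ereal (pi/2)|lborel. f x) = (LINT x|lborel. indicator {- pi/2..pi/2} x *\<^sub>R f x)"
    by (simp add: interval_integral_Icc set_lebesgue_integral_def)
  also have "\<dots> = (LINT x|lborel. indicator {- pi/2..pi/2} (- pi/2 + 1 * x) *\<^sub>R f (- pi/2 + 1 * x))"
    by (subst lborel_integral_real_affine[where c = 1 and t = "- pi/2"]) simp_all
  also have "\<dots> = (LINT x:{0..pi}|lborel. f (x - pi/2))"
    unfolding set_lebesgue_integral_def
    by (intro Bochner_Integration.integral_cong) (auto simp: indicator_def field_simps)
  finally show ?thesis .
qed

text \<open>Writing the Cauchy characteristic function as that of a single tangent makes
  \<open>char_tan_combination\<close> compute it as well.\<close>
lemma char_cauchy: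
  "char (density lborel (cauchy_density 0 1)) s = (\<integral>\<phi>. iexp (s * tan (\<phi> - pi/2)) \<partial>uniform_circle_pi)"
proof -
  have lims: "((ereal \<circ> tan \<circ> real_of_ereal) \<longlongrightarrow> -\<infinity>) (at_right (ereal (- pi / 2)))"
    "((ereal \<circ> tan \<circ> real_of_ereal) \<longlongrightarrow> \<infinity>) (at_left (ereal (pi / 2)))"
    using filterlim_tan_at_right filterlim_tan_at_left
    by (simp_all add: o_assoc ereal_tendsto_simps)
  have cz: "cos x \<noteq> 0" if "ereal (- pi / 2) < ereal x" "ereal x < ereal (pi / 2)" for x
    using cos_gt_zero_pi[of x] that by simp
  have der: "DERIV tan x :> 1 + (tan x)\<^sup>2" if "ereal (- pi / 2) < ereal x" "ereal x < ereal (pi / 2)" for x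
    using DERIV_tan[OF cz[OF that]] by (simp add: tan_sec[OF cz[OF that]] power_inverse)
  have cont: "isCont (\<lambda>x. 1 + (tan x)\<^sup>2) x" if "ereal (- pi / 2) < ereal x" "ereal x < ereal (pi / 2)" for x
    using cz[OF that] by (intro continuous_intros) auto
  let ?f = "\<lambda>x. cauchy_density 0 1 x *\<^sub>R iexp (s * x)"
  have weight: "(1 + (tan x)\<^sup>2) *\<^sub>R ?f (tan x) = iexp (s * tan x) / pi" for x
    using cauchy_density_tan_jacobian[of x] by (simp only: scaleR_scaleR) (simp add: scaleR_conv_of_real)
  have "(LBINT x=-\<infinity>..\<infinity>. ?f x) = (LBINT x=ereal (- pi/2)..ereal (pi/2). (1 + (tan x)\<^sup>2) *\<^sub>R ?f (tan x))"
  proof (rule interval_integral_substitution_integrable[OF _ der _ cont _ lims])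
    show "isCont ?f (tan x)" for x
      by (intro continuous_intros isCont_cauchy_density)
    show "set_integrable lborel (einterval (ereal (- pi/2)) (ereal (pi/2))) (\<lambda>x. (1 + (tan x)\<^sup>2) *\<^sub>R ?f (tan x))"
      unfolding weight set_integrable_def
      by (rule integrableI_bounded_set[where A = "einterval (ereal (- pi/2)) (ereal (pi/2))" and B = "1/pi"])
         (auto simp: norm_divide indicator_def einterval_eq)
    show "set_integrable lborel (einterval (-\<infinity>) \<infinity>) ?f"
      unfolding set_integrable_def
      by (rule Bochner_Integration.integrable_bound[OF integral_cauchy_density(1)])
         (auto simp: less_imp_le[OF cauchy_density_pos])
  qed (auto simp: pi_gt_zero)
  also have "\<dots> = (LINT x:{0..pi}|lborel. iexp (s * tan (x - pi/2)) / pi)"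
    unfolding weight by (rule LINT_shift_half_pi) measurable
  also have "\<dots> = (\<integral>\<phi>. iexp (s * tan (\<phi> - pi/2)) \<partial>uniform_circle_pi)"
    by (subst integral_uniform_circle_pi) (auto simp: set_lebesgue_integral_def)
  finally show ?thesis
    by (simp add: char_def integral_density less_imp_le[OF cauchy_density_pos]
       interval_lebesgue_integral_def set_lebesgue_integral_def)
qed

text \<open>The characteristic function at \<open>- s\<close> is the complex conjugate of the one at \<open>s\<close>.\<close>
lemma distr_eqI_char_nonneg:
  assumes M: "real_distribution M" and N: "real_distribution N"
    and eq: "\<And>s. 0 \<le> s \<Longrightarrow> char M s = char N s"
  shows "M = N"
proof (rule Levy_uniqueness[OF M N], rule ext)
  fix s :: real
  have cnj: "char K (- t) = cnj (char K t)" for K t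
    unfolding char_def by (simp add: exp_cnj flip: Bochner_Integration.integral_cnj)
  show "char M s = char N s"
    using eq[of s] eq[of "- s"] cnj[of M "- s"] cnj[of N "- s"] by (cases "0 \<le> s") auto
qed

lemma cauchy_universal_if_nonneg:
  fixes c :: "real^'k::finite"
  assumes c: "\<And>j. 0 \<le> c $ j" "(\<Sum>j\<in>UNIV. c $ j) = 1"
  shows "cauchy_universal c"
  unfolding cauchy_universal_def distributed_def
proof (intro allI conjI)
  fix \<alpha> :: "'k \<Rightarrow> real"
  let ?f = "\<lambda>\<phi>. \<Sum>j\<in>UNIV. c $ j * tan (\<phi> - \<alpha> j)"
  interpret prob_space uniform_circle_pi by (rule prob_space_uniform_circle_pi)
  have [measurable]: "?f \<in> borel_measurable borel" by measurable
  then show "?f \<in> measurable uniform_circle_pi lborel" by simp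
  have "distr uniform_circle_pi borel ?f = density lborel (cauchy_density 0 1)"
  proof (rule distr_eqI_char_nonneg[OF real_distribution_distr real_distribution_cauchy])
    show "random_variable borel ?f" by simp
    fix s :: real assume s: "0 \<le> s"
    have "char (distr uniform_circle_pi borel ?f) s = exp (- s)"
      using char_tan_combination[OF c s, of \<alpha>] by (simp add: char_def integral_distr)
    moreover have "char (density lborel (cauchy_density 0 1)) s = exp (- s)"
      unfolding char_cauchy
      using char_tan_combination[OF c s, of "\<lambda>_. pi/2"] by (simp add: sum_distrib_right[symmetric] c(2))
    ultimately show "char (distr uniform_circle_pi borel ?f) s = char (density lborel (cauchy_density 0 1)) s"
      by simp
  qed
  then show "distr uniform_circle_pi lborel ?f = density lborel (\<lambda>x. ennreal (cauchy_density 0 1 x))"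
    by (simp cong: distr_cong)
  show "(\<lambda>x. ennreal (cauchy_density 0 1 x)) \<in> borel_measurable lborel" by simp
qed

section \<open>Gaussian vectors and rotations of pairs\<close>

lemma gaussian_integral_real:
  "integrable lborel (\<lambda>t::real. iexp (u * t) * complex_of_real (exp (- t\<^sup>2)))"
  "(LINT t|lborel. iexp (u * t) * complex_of_real (exp (- t\<^sup>2))) = complex_of_real (sqrt pi * exp (- u\<^sup>2 / 4))"
proof -
  have int: "integrable lborel (\<lambda>t::real. exp (- t\<^sup>2))"
    using gaussian_moment_even_pos[of 0] has_bochner_integral_even_function[of "\<lambda>t::real. exp (- t\<^sup>2)"]
    by (auto simp: has_bochner_integral_iff)
  show "integrable lborel (\<lambda>t::real. iexp (u * t) * complex_of_real (exp (- t\<^sup>2)))"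
    by (rule Bochner_Integration.integrable_bound[OF int]) (auto simp: norm_mult)
  have "complex_of_real (exp (- (u / sqrt 2)\<^sup>2 / 2)) = char std_normal_distribution (u / sqrt 2)"
    by (simp add: char_std_normal_distribution)
  also have "\<dots> = (LINT x|lborel. std_normal_density x *\<^sub>R iexp (u / sqrt 2 * x))"
    unfolding char_def by (subst integral_density) auto
  also have "\<dots> = complex_of_real (sqrt 2) * (LINT t|lborel. std_normal_density (0 + sqrt 2 * t) *\<^sub>R iexp (u / sqrt 2 * (0 + sqrt 2 * t)))"
    by (subst lborel_integral_real_affine[where c = "sqrt 2" and t = 0]) (simp_all add: scaleR_conv_of_real)
  also have "(\<lambda>t. std_normal_density (0 + sqrt 2 * t) *\<^sub>R iexp (u / sqrt 2 * (0 + sqrt 2 * t)))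
      = (\<lambda>t. complex_of_real (1 / sqrt (2 * pi)) * (iexp (u * t) * complex_of_real (exp (- t\<^sup>2))))"
    by (simp add: std_normal_density_def power_mult_distrib scaleR_conv_of_real mult_ac)
  also have "complex_of_real (sqrt 2) * (LINT t|lborel. complex_of_real (1 / sqrt (2 * pi)) * (iexp (u * t) * complex_of_real (exp (- t\<^sup>2))))
     = complex_of_real (sqrt 2 * (1 / sqrt (2 * pi))) * (LINT t|lborel. iexp (u * t) * complex_of_real (exp (- t\<^sup>2)))"
    by simp
  also have "sqrt 2 * (1 / sqrt (2 * pi)) = 1 / sqrt pi"
    by (simp add: real_sqrt_mult)
  finally show "(LINT t|lborel. iexp (u * t) * complex_of_real (exp (- t\<^sup>2))) = complex_of_real (sqrt pi * exp (- u\<^sup>2 / 4))"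
    by (simp add: field_simps power_divide)
qed

lemma integral_lborel_prod:
  fixes f :: "'a::euclidean_space \<Rightarrow> real \<Rightarrow> complex"
  assumes f: "\<And>b. b \<in> Basis \<Longrightarrow> integrable lborel (f b)"
  shows "integrable lborel (\<lambda>x. \<Prod>b\<in>Basis. f b (x \<bullet> b))"
    and "(LINT x|lborel. (\<Prod>b\<in>Basis. f b (x \<bullet> b))) = (\<Prod>b\<in>Basis. LINT t|lborel. f b t)"
proof -
  interpret product_sigma_finite "\<lambda>_::'a. lborel :: real measure" ..
  let ?M = "\<Pi>\<^sub>M b\<in>(Basis::'a set). (lborel :: real measure)"
  let ?T = "\<lambda>g. \<Sum>b\<in>(Basis::'a set). g b *\<^sub>R b"
  have leb: "(lborel :: 'a measure) = distr ?M borel ?T"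
    unfolding lborel_def[where 'a = 'a] lborel_eq_real ..
  have [measurable]: "f b \<in> borel_measurable borel" if "b \<in> Basis" for b
    using borel_measurable_integrable[OF f[OF that]] by simp
  have m: "(\<lambda>x. \<Prod>b\<in>Basis. f b (x \<bullet> b)) \<in> borel_measurable borel"
    by (intro borel_measurable_prod) measurable
  have T: "?T \<in> measurable ?M borel" by measurable
  have eq: "(\<Prod>b\<in>Basis. f b (?T g \<bullet> b)) = (\<Prod>b\<in>Basis. f b (g b))" for g
    by (intro prod.cong) auto
  show "integrable lborel (\<lambda>x. \<Prod>b\<in>Basis. f b (x \<bullet> b))"
    unfolding leb integrable_distr_eq[OF T m] eq by (rule product_integrable_prod) (use f in auto)
  show "(LINT x|lborel. (\<Prod>b\<in>Basis. f b (x \<bullet> b))) = (\<Prod>b\<in>Basis. LINT t|lborel. f b t)"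
    unfolding leb integral_distr[OF T m] eq by (rule product_integral_prod) (use f in auto)
qed

text \<open>Each coordinate has variance \<open>1/2\<close>, so that radial moments are integrals against
  \<open>exp (- t\<^sup>2)\<close>.\<close>
definition gaussian :: "'a::euclidean_space measure" where
  "gaussian = density lborel (\<lambda>x. ennreal (exp (- (norm x)\<^sup>2) / sqrt pi ^ DIM('a)))"

lemma sets_gaussian [simp, measurable_cong]: "sets gaussian = sets borel"
  and space_gaussian [simp]: "space gaussian = UNIV"
  by (simp_all add: gaussian_def)

lemma gaussian_integral_lborel:
  fixes v :: "'a::euclidean_space"
  shows "integrable lborel (\<lambda>x. iexp (v \<bullet> x) * complex_of_real (exp (- (norm x)\<^sup>2)))"
    and "(LINT x|lborel. iexp (v \<bullet> x) * complex_of_real (exp (- (norm x)\<^sup>2)))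
      = complex_of_real (sqrt pi ^ DIM('a) * exp (- (norm v)\<^sup>2 / 4))"
proof -
  have sq: "(norm x)\<^sup>2 = (\<Sum>b\<in>Basis. (x \<bullet> b)\<^sup>2)" for x :: 'a
    unfolding power2_norm_eq_inner euclidean_inner[of x x] by (simp add: power2_eq_square)
  have e1: "iexp (v \<bullet> x) = (\<Prod>b\<in>Basis. iexp ((v \<bullet> b) * (x \<bullet> b)))" for x
    unfolding euclidean_inner[of v x] of_real_sum sum_distrib_left by (rule exp_sum) simp
  have e2: "exp (- (norm x)\<^sup>2 / d) = (\<Prod>b\<in>Basis. exp (- (x \<bullet> b)\<^sup>2 / d))" for x :: 'a and d :: real
    unfolding sq sum_negf[symmetric] sum_divide_distrib by (rule exp_sum) simp
  have eq: "iexp (v \<bullet> x) * complex_of_real (exp (- (norm x)\<^sup>2)) =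
     (\<Prod>b\<in>Basis. iexp ((v \<bullet> b) * (x \<bullet> b)) * complex_of_real (exp (- (x \<bullet> b)\<^sup>2)))" for x
    unfolding prod.distrib e1 using e2[of x 1] by simp
  show "integrable lborel (\<lambda>x. iexp (v \<bullet> x) * complex_of_real (exp (- (norm x)\<^sup>2)))"
    unfolding eq by (rule integral_lborel_prod) (rule gaussian_integral_real)
  have "(LINT x|lborel. iexp (v \<bullet> x) * complex_of_real (exp (- (norm x)\<^sup>2))) =
     (\<Prod>b\<in>Basis. LINT t|lborel. iexp ((v \<bullet> b) * t) * complex_of_real (exp (- t\<^sup>2)))"
    unfolding eq by (rule integral_lborel_prod) (rule gaussian_integral_real)
  also have "\<dots> = (\<Prod>b\<in>(Basis::'a set). complex_of_real (sqrt pi * exp (- (v \<bullet> b)\<^sup>2 / 4)))"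
    unfolding gaussian_integral_real ..
  also have "\<dots> = complex_of_real (\<Prod>b\<in>(Basis::'a set). sqrt pi * exp (- (v \<bullet> b)\<^sup>2 / 4))"
    by (rule of_real_prod[symmetric])
  also have "(\<Prod>b\<in>(Basis::'a set). sqrt pi * exp (- (v \<bullet> b)\<^sup>2 / 4)) = sqrt pi ^ DIM('a) * exp (- (norm v)\<^sup>2 / 4)"
    unfolding prod.distrib e2 by simp
  finally show "(LINT x|lborel. iexp (v \<bullet> x) * complex_of_real (exp (- (norm x)\<^sup>2)))
      = complex_of_real (sqrt pi ^ DIM('a) * exp (- (norm v)\<^sup>2 / 4))" .
qed

lemma char_gaussian:
  fixes v :: "'a::euclidean_space"
  shows "(\<integral>x. iexp (v \<bullet> x) \<partial>gaussian) = exp (- (norm v)\<^sup>2 / 4)"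
proof -
  have "(\<integral>x. iexp (v \<bullet> x) \<partial>gaussian) =
      (LINT x|lborel. (exp (- (norm x)\<^sup>2) / sqrt pi ^ DIM('a)) *\<^sub>R iexp (v \<bullet> x))"
    unfolding gaussian_def by (rule integral_density) auto
  also have "\<dots> = (LINT x|lborel. (iexp (v \<bullet> x) * complex_of_real (exp (- (norm x)\<^sup>2))) / complex_of_real (sqrt pi ^ DIM('a)))"
    by (simp add: scaleR_conv_of_real mult.commute)
  also have "\<dots> = exp (- (norm v)\<^sup>2 / 4)"
    unfolding integral_divide_zero gaussian_integral_lborel by simp
  finally show ?thesis .
qed

lemma prob_space_gaussian: "prob_space (gaussian :: 'a::euclidean_space measure)"
proof
  let ?f = "\<lambda>x::'a. exp (- (norm x)\<^sup>2)"
  have "complex_of_real (LINT x|lborel. ?f x) = complex_of_real (sqrt pi ^ DIM('a))"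
    using gaussian_integral_lborel(2)[of "0::'a"] by simp
  moreover have "integrable lborel ?f"
    using integrable_Re[OF gaussian_integral_lborel(1)[of "0::'a"]] by simp
  ultimately have "(\<integral>\<^sup>+x. ennreal (?f x) \<partial>lborel) = ennreal (sqrt pi ^ DIM('a))"
    by (simp add: nn_integral_eq_integral of_real_eq_iff del: of_real_power)
  then have "(\<integral>\<^sup>+x. ennreal (?f x) / ennreal (sqrt pi ^ DIM('a)) \<partial>lborel) = 1"
    by (subst nn_integral_divide) (auto simp: ennreal_divide_self)
  then show "emeasure (gaussian :: 'a measure) (space gaussian) = 1"
    by (simp add: gaussian_def emeasure_density divide_ennreal)
qed

lemma gaussian_pair:
  "gaussian \<Otimes>\<^sub>M gaussian = (gaussian :: ('a::euclidean_space \<times> 'b::euclidean_space) measure)"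
proof -
  have "sigma_finite_measure (gaussian :: 'b measure)"
    by (simp add: prob_space_gaussian prob_space_imp_sigma_finite)
  then have "gaussian \<Otimes>\<^sub>M gaussian = density (lborel \<Otimes>\<^sub>M lborel)
     (\<lambda>(x::'a, y::'b). ennreal (exp (- (norm x)\<^sup>2) / sqrt pi ^ DIM('a)) * ennreal (exp (- (norm y)\<^sup>2) / sqrt pi ^ DIM('b)))"
    unfolding gaussian_def by (intro pair_measure_density) (auto simp: lborel.sigma_finite_measure_axioms)
  also have "\<dots> = gaussian"
    unfolding lborel_prod gaussian_def
    by (intro arg_cong2[where f = density] refl ext)
       (auto simp: norm_Pair power_add ennreal_mult'[symmetric] exp_add[symmetric] mult_exp_exp split: prod.splits)
  finally show ?thesis .
qed

text \<open>The density depends on the norm only, and Lebesgue measure is invariant.\<close>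
lemma gaussian_orthogonal:
  fixes T :: "'a::euclidean_space \<Rightarrow> 'a"
  assumes T: "orthogonal_transformation T"
  shows "distr gaussian borel T = gaussian"
proof -
  have [measurable]: "T \<in> borel_measurable borel"
    using T by (intro borel_measurable_continuous_onI linear_continuous_on linear_conv_bounded_linear[THEN iffD1])
      (auto simp: orthogonal_transformation_linear)
  have "gaussian = density (distr lborel borel T) (\<lambda>x. ennreal (exp (- (norm x)\<^sup>2) / sqrt pi ^ DIM('a)))"
    by (simp add: gaussian_def distr_lborel_orthogonal[OF T])
  also have "\<dots> = distr gaussian borel T"
    unfolding gaussian_def by (subst density_distr) (simp_all add: orthogonal_transformation_norm[OF T])
  finally show ?thesis ..
qed

text \<open>Rotation of every coordinate pair \<open>(x\<^sub>i, y\<^sub>i)\<close> by the same angle; it commutes with linear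
  functionals, so it also rotates every pair \<open>(a \<bullet> x, a \<bullet> y)\<close>.\<close>
definition plane_rotation :: "real \<Rightarrow> 'a::euclidean_space \<times> 'a \<Rightarrow> 'a \<times> 'a" where
  "plane_rotation \<phi> z =
     (cos \<phi> *\<^sub>R fst z - sin \<phi> *\<^sub>R snd z, sin \<phi> *\<^sub>R fst z + cos \<phi> *\<^sub>R snd z)"

lemma orthogonal_plane_rotation: "orthogonal_transformation (plane_rotation \<phi>)"
  unfolding orthogonal_transformation
proof (intro conjI allI)
  show "linear (plane_rotation \<phi>)"
    by (rule linearI) (auto simp: plane_rotation_def algebra_simps)
  fix z :: "'a \<times> 'a"
  obtain x y where z: "z = (x, y)" by fastforce
  have "(norm (plane_rotation \<phi> z))\<^sup>2 = x \<bullet> x + y \<bullet> y"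
    unfolding power2_norm_eq_inner plane_rotation_def z
    by (simp add: inner_Pair inner_add inner_diff inner_commute[of y x] algebra_simps)
       (insert sin_cos_squared_add3[of \<phi>], algebra)
  also have "\<dots> = (norm z)\<^sup>2"
    by (simp add: power2_norm_eq_inner z inner_Pair)
  finally show "norm (plane_rotation \<phi> z) = norm z"
    by (simp add: power2_eq_iff_nonneg)
qed

lemma borel_measurable_hyperplane_field [measurable]:
  "hyperplane_field a c \<in> borel_measurable borel"
  unfolding hyperplane_field_def[abs_def] by measurable

lemma inner_hyperplane_field:
  "hyperplane_field a c x \<bullet> y = (\<Sum>j\<in>UNIV. c $ j * ((a j \<bullet> y) / (a j \<bullet> x)))"
  by (simp add: hyperplane_field_def inner_sum_left divide_inverse mult_ac)

text \<open>In polar coordinates \<open>(a\<^sub>j \<bullet> x, a\<^sub>j \<bullet> y)\<close> has some angle \<open>t\<^sub>j\<close>, which the rotation changes to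
  \<open>\<phi> + t\<^sub>j\<close>; the quotient of the coordinates is then its tangent.\<close>
lemma inner_hyperplane_field_rotation:
  assumes nz: "\<And>j. a j \<bullet> fst z \<noteq> 0"
  obtains \<theta> where "\<And>\<phi>. hyperplane_field a c (fst (plane_rotation \<phi> z)) \<bullet> snd (plane_rotation \<phi> z)
     = (\<Sum>j\<in>UNIV. c $ j * tan (\<phi> - \<theta> j))"
proof -
  have "\<exists>r t. r \<noteq> 0 \<and> a j \<bullet> fst z = r * cos t \<and> a j \<bullet> snd z = r * sin t" for j
    using polar_Ex[of "a j \<bullet> fst z" "a j \<bullet> snd z"] nz[of j] by force
  then obtain r t where rt: "\<And>j. r j \<noteq> 0" "\<And>j. a j \<bullet> fst z = r j * cos (t j)" "\<And>j. a j \<bullet> snd z = r j * sin (t j)"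
    by metis
  show ?thesis
  proof (rule that[of "\<lambda>j. - t j"])
    fix \<phi>
    have "a j \<bullet> fst (plane_rotation \<phi> z) = r j * cos (\<phi> - - t j)"
         "a j \<bullet> snd (plane_rotation \<phi> z) = r j * sin (\<phi> - - t j)" for j
      by (simp_all add: plane_rotation_def inner_add_right inner_diff_right rt cos_add sin_add algebra_simps)
    then show "hyperplane_field a c (fst (plane_rotation \<phi> z)) \<bullet> snd (plane_rotation \<phi> z)
     = (\<Sum>j\<in>UNIV. c $ j * tan (\<phi> - - t j))"
      unfolding inner_hyperplane_field using rt(1) by (simp add: tan_def)
  qed
qed

lemma AE_lborel_inner_nonzero:
  fixes a :: "'a::euclidean_space"
  assumes "a \<noteq> 0" shows "AE x in lborel. a \<bullet> x \<noteq> 0"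
proof -
  have "{x. a \<bullet> x = 0} \<in> null_sets lborel"
    using negligible_hyperplane[of a 0] assms
    by (auto simp: negligible_iff_null_sets null_sets_completion_iff closed_hyperplane borel_closed)
  then show ?thesis by (rule AE_I') auto
qed

lemma AE_gaussian: "AE x in lborel. P x \<Longrightarrow> AE x in gaussian. P x"
  unfolding gaussian_def by (subst AE_density) auto

text \<open>Both sides compute \<open>E exp (i s g(X) \<bullet> Y)\<close> for independent Gaussian \<open>X\<close> and \<open>Y\<close>: integrating
  over \<open>Y\<close> first gives the left side, averaging over all rotations of \<open>(X, Y)\<close> gives the right side.\<close>
lemma gaussian_transform_field:
  fixes c :: "real^'k::finite" and a :: "'k \<Rightarrow> real^'p::finite"
  assumes c: "\<And>j. 0 \<le> c $ j" "(\<Sum>j\<in>UNIV. c $ j) = 1" and a: "\<And>j. a j \<noteq> 0" and s: "0 \<le> s"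
  shows "(\<integral>x. exp (- s\<^sup>2 * (norm (hyperplane_field a c x))\<^sup>2 / 4) \<partial>gaussian) = exp (- s)"
proof -
  let ?G = "gaussian :: (real^'p) measure" and ?H = "gaussian :: ((real^'p) \<times> (real^'p)) measure"
  let ?U = uniform_circle_pi
  interpret G: prob_space ?G by (rule prob_space_gaussian)
  interpret G2: prob_space ?H by (rule prob_space_gaussian)
  interpret U: prob_space ?U by (rule prob_space_uniform_circle_pi)
  interpret GG: pair_prob_space ?G ?G ..
  interpret UG: pair_prob_space ?U ?H ..
  define K where "K = (\<lambda>z. iexp (s * (hyperplane_field a c (fst z) \<bullet> snd z)))"
  have K [measurable]: "K \<in> borel_measurable (borel \<Otimes>\<^sub>M borel)"
    unfolding K_def by measurable
  then have Kb [measurable]: "K \<in> borel_measurable borel" by (simp add: borel_prod)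
  have rot [measurable]: "(\<lambda>(\<phi>, z). plane_rotation \<phi> z) \<in> borel_measurable (borel \<Otimes>\<^sub>M (borel :: ((real^'p) \<times> (real^'p)) measure))"
    unfolding plane_rotation_def borel_prod
    by (intro borel_measurable_continuous_onI) (auto intro!: continuous_intros simp: split_beta)
  have bd: "cmod (K z) = 1" for z by (simp add: K_def)
  have "(\<integral>z. K z \<partial>?H) = (\<integral>x. (\<integral>y. K (x, y) \<partial>?G) \<partial>?G)"
    unfolding gaussian_pair[symmetric]
    by (rule GG.integral_fst'[symmetric]) (rule GG.integrable_const_bound[where B = 1]; simp add: bd)
  also have "\<dots> = (\<integral>x. complex_of_real (exp (- s\<^sup>2 * (norm (hyperplane_field a c x))\<^sup>2 / 4)) \<partial>?G)"
  proof (rule Bochner_Integration.integral_cong[OF refl])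
    fix x
    show "(\<integral>y. K (x, y) \<partial>?G) = complex_of_real (exp (- s\<^sup>2 * (norm (hyperplane_field a c x))\<^sup>2 / 4))"
      using char_gaussian[of "s *\<^sub>R hyperplane_field a c x"] by (simp add: K_def power_mult_distrib)
  qed
  also have "\<dots> = complex_of_real (\<integral>x. exp (- s\<^sup>2 * (norm (hyperplane_field a c x))\<^sup>2 / 4) \<partial>?G)"
    by (rule integral_complex_of_real)
  finally have 1: "(\<integral>z. K z \<partial>?H) = complex_of_real (\<integral>x. exp (- s\<^sup>2 * (norm (hyperplane_field a c x))\<^sup>2 / 4) \<partial>?G)" .
  have "(\<integral>z. K z \<partial>?H) = (\<integral>\<phi>. (\<integral>z. K (plane_rotation \<phi> z) \<partial>?H) \<partial>?U)"
  proof -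
    have "(\<integral>z. K (plane_rotation \<phi> z) \<partial>?H) = (\<integral>z. K z \<partial>?H)" for \<phi>
    proof -
      have "plane_rotation \<phi> \<in> borel_measurable (borel :: ((real^'p) \<times> (real^'p)) measure)"
        using measurable_Pair2[OF rot, of \<phi>] by simp
      then have "(\<integral>z. K (plane_rotation \<phi> z) \<partial>?H) = (\<integral>z. K z \<partial>distr ?H borel (plane_rotation \<phi>))"
        by (subst integral_distr) auto
      then show ?thesis by (simp add: gaussian_orthogonal[OF orthogonal_plane_rotation])
    qed
    then show ?thesis using U.prob_space by simp
  qed
  also have "\<dots> = (\<integral>z. (\<integral>\<phi>. K (plane_rotation \<phi> z) \<partial>?U) \<partial>?H)"
  proof (rule UG.Fubini_integral[symmetric])
    have "(\<lambda>(\<phi>, z). K (plane_rotation \<phi> z)) \<in> borel_measurable (borel \<Otimes>\<^sub>M borel)"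
      using measurable_compose[OF rot Kb] by (simp add: split_beta')
    then have "(\<lambda>(\<phi>, z). K (plane_rotation \<phi> z)) \<in> borel_measurable (?U \<Otimes>\<^sub>M ?H)"
      by (simp cong: measurable_cong_sets)
    then show "integrable (?U \<Otimes>\<^sub>M ?H) (\<lambda>(\<phi>, z). K (plane_rotation \<phi> z))"
      by (intro UG.integrable_const_bound[where B = 1]) (auto simp: bd)
  qed
  also have "\<dots> = (\<integral>z. complex_of_real (exp (- s)) \<partial>?H)"
  proof (rule integral_cong_AE)
    have "(\<lambda>(z, \<phi>). K (plane_rotation \<phi> z)) \<in> borel_measurable (borel \<Otimes>\<^sub>M borel)"
      using measurable_compose[OF measurable_pair_swap' measurable_compose[OF rot Kb]] by (simp add: split_beta')
    then have "(\<lambda>(z, \<phi>). K (plane_rotation \<phi> z)) \<in> borel_measurable (?H \<Otimes>\<^sub>M ?U)"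
      by (simp cong: measurable_cong_sets)
    then show "(\<lambda>z. \<integral>\<phi>. K (plane_rotation \<phi> z) \<partial>?U) \<in> borel_measurable ?H"
      by (rule U.borel_measurable_lebesgue_integral)
    \<comment> \<open>off the null set of all \<open>z\<close> with \<open>a j \<bullet> fst z = 0\<close> the inner average is a sum of tangents\<close>
    have "AE z in (lborel :: ((real^'p) \<times> (real^'p)) measure). a j \<bullet> fst z \<noteq> 0" for j
      using AE_lborel_inner_nonzero[of "(a j, 0 :: real^'p)"] a[of j] by (simp add: inner_prod_def zero_prod_def)
    then have "AE z in ?H. \<forall>j. a j \<bullet> fst z \<noteq> 0"
      by (intro eventually_all_finite AE_gaussian)
    then show "AE z in ?H. (\<integral>\<phi>. K (plane_rotation \<phi> z) \<partial>?U) = exp (- s)"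
    proof eventually_elim
      fix z :: "(real^'p) \<times> (real^'p)" assume "\<forall>j. a j \<bullet> fst z \<noteq> 0"
      then obtain \<theta> where "\<And>\<phi>. hyperplane_field a c (fst (plane_rotation \<phi> z)) \<bullet> snd (plane_rotation \<phi> z)
          = (\<Sum>j\<in>UNIV. c $ j * tan (\<phi> - \<theta> j))"
        using inner_hyperplane_field_rotation[of a z c] by metis
      then show "(\<integral>\<phi>. K (plane_rotation \<phi> z) \<partial>?U) = exp (- s)"
        unfolding K_def using char_tan_combination[OF c s, of \<theta>] by simp
    qed
  qed simp
  also have "\<dots> = exp (- s)" using G2.prob_space by simp
  finally show ?thesis using 1 by (metis of_real_eq_iff)
qed

section \<open>Polar coordinates and moments\<close>

lemma Gamma_half_nat: "Gamma (real k + 1/2) = sqrt pi * (fact (2 * k) / (2 ^ (2 * k) * fact k))"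
proof (induction k)
  case 0
  then show ?case by (simp add: Gamma_one_half_real)
next
  case (Suc k)
  have "Gamma (real (Suc k) + 1/2) = (real k + 1/2) * Gamma (real k + 1/2)"
    using Gamma_plus1[of "real k + 1/2"] by (simp add: nonpos_Ints_def add_ac)
  also have "\<dots> = sqrt pi * ((real k + 1/2) * (fact (2 * k) / (2 ^ (2 * k) * fact k)))"
    unfolding Suc.IH by simp
  also have "(real k + 1/2) * (fact (2 * k) / (2 ^ (2 * k) * fact k))
      = ((2 * real k + 2) * (2 * real k + 1) * fact (2 * k)) / (4 * 2 ^ (2 * k) * ((real k + 1) * fact k))"
  proof -
    have "(real k + 1/2) * (x / (y * z)) = ((2 * real k + 2) * (2 * real k + 1) * x) / (4 * y * ((real k + 1) * z))"
      if "y \<noteq> 0" "z \<noteq> 0" for x y z :: real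
    proof -
      have "4 * y * ((real k + 1) * z) \<noteq> 0" using that by (simp add: add_nonneg_eq_0_iff)
      then show ?thesis using that by (simp add: frac_eq_eq) (simp add: algebra_simps)
    qed
    then show ?thesis by simp
  qed
  also have "\<dots> = fact (2 * Suc k) / (2 ^ (2 * Suc k) * fact (Suc k))"
    by (simp add: algebra_simps)
  finally show ?case .
qed

lemma nn_integral_gaussian_moment:
  "(\<integral>\<^sup>+t. ennreal (t ^ m * exp (- t\<^sup>2)) * indicator {0..} t \<partial>lborel) = ennreal (Gamma ((real m + 1) / 2) / 2)"
proof -
  have "has_bochner_integral lborel (\<lambda>t::real. indicator {0..} t *\<^sub>R (exp (- t\<^sup>2) * t ^ m)) (Gamma ((real m + 1) / 2) / 2)"
  proof (cases "even m")
    case True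
    then obtain k where m: "m = 2 * k" by blast
    have e: "(real m + 1) / 2 = real k + 1/2" by (simp add: m)
    show ?thesis
      unfolding e Gamma_half_nat using gaussian_moment_even_pos[of k] by (simp add: m mult_ac)
  next
    case False
    then obtain k where m: "m = 2 * k + 1" by (metis oddE)
    have e: "(real m + 1) / 2 = 1 + real k" by (simp add: m)
    show ?thesis
      unfolding e Gamma_fact using gaussian_moment_odd_pos[of k] by (simp add: m)
  qed
  then have "(\<integral>\<^sup>+t. ennreal (indicator {0..} t *\<^sub>R (exp (- t\<^sup>2) * t ^ m)) \<partial>lborel) = ennreal (Gamma ((real m + 1) / 2) / 2)"
    by (subst nn_integral_eq_integral) (auto simp: has_bochner_integral_iff indicator_def)
  also have "(\<integral>\<^sup>+t. ennreal (indicator {0..} t *\<^sub>R (exp (- t\<^sup>2) * t ^ m)) \<partial>lborel)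
     = (\<integral>\<^sup>+t. ennreal (t ^ m * exp (- t\<^sup>2)) * indicator {0..} t \<partial>lborel)"
    by (intro nn_integral_cong) (auto simp: indicator_def mult.commute)
  finally show ?thesis .
qed

lemma nn_integral_ball_homogeneous:
  fixes F :: "'a::euclidean_space \<Rightarrow> ennreal"
  assumes [measurable]: "F \<in> borel_measurable borel"
    and F: "\<And>c x. 0 < c \<Longrightarrow> F (c *\<^sub>R x) = F x" and r: "0 < r"
  shows "(\<integral>\<^sup>+x. F x * indicator (ball 0 r) x \<partial>lborel) =
      ennreal (r ^ DIM('a)) * (\<integral>\<^sup>+x. F x * indicator (ball 0 1) x \<partial>lborel)"
proof -
  have [measurable]: "(\<lambda>x. F x * indicator (ball 0 s) x) \<in> borel_measurable borel" for s
    by (intro borel_measurable_times_ennreal borel_measurable_indicator) auto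
  have "(\<integral>\<^sup>+x. F x * indicator (ball 0 r) x \<partial>lborel) =
    (\<integral>\<^sup>+x. F x * indicator (ball 0 r) x \<partial>density (distr lborel borel (\<lambda>x. 0 + r *\<^sub>R x)) (\<lambda>_. ennreal (\<bar>r\<bar> ^ DIM('a))))"
    using lborel_affine[of r "0::'a"] r by simp
  also have "\<dots> = (\<integral>\<^sup>+x. ennreal (r ^ DIM('a)) * (F x * indicator (ball 0 r) x) \<partial>distr lborel borel (\<lambda>x. 0 + r *\<^sub>R x))"
    using r by (subst nn_integral_density) auto
  also have "\<dots> = (\<integral>\<^sup>+x. ennreal (r ^ DIM('a)) * (F (r *\<^sub>R x) * indicator (ball 0 r) (r *\<^sub>R x)) \<partial>lborel)"
    by (subst nn_integral_distr) auto
  also have "\<dots> = (\<integral>\<^sup>+x. ennreal (r ^ DIM('a)) * (F x * indicator (ball 0 1) x) \<partial>lborel)"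
    using r by (intro nn_integral_cong) (auto simp: F indicator_def)
  finally show ?thesis by (simp add: nn_integral_cmult)
qed

text \<open>The image of \<open>F(x) dx\<close> under the norm is determined by the integrals of \<open>F\<close> over balls, and
  these are proportional to \<open>r\<^sup>d\<close> because \<open>F\<close> is homogeneous of degree 0.\<close>
lemma nn_integral_polar:
  fixes F :: "'a::euclidean_space \<Rightarrow> ennreal"
  assumes [measurable]: "F \<in> borel_measurable borel" "h \<in> borel_measurable borel"
    and F: "\<And>c x. 0 < c \<Longrightarrow> F (c *\<^sub>R x) = F x"
    and fin: "(\<integral>\<^sup>+x. F x * indicator (ball 0 1) x \<partial>lborel) < \<infinity>"
  shows "(\<integral>\<^sup>+x. F x * h (norm x) \<partial>lborel) = (\<integral>\<^sup>+x. F x * indicator (ball 0 1) x \<partial>lborel) *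
     (\<integral>\<^sup>+t. ennreal (DIM('a) * t ^ (DIM('a) - 1)) * h t * indicator {0..} t \<partial>lborel)"
proof -
  let ?d = "DIM('a)"
  define V where "V = (\<integral>\<^sup>+x. F x * indicator (ball 0 1) x \<partial>lborel)"
  define M where "M = distr (density lborel F) borel norm"
  define N where "N = density lborel (\<lambda>t::real. V * (ennreal (?d * t ^ (?d - 1)) * indicator {0..} t))"
  have M: "emeasure M {..<r} = (if 0 < r then ennreal (r ^ ?d) * V else 0)" for r
  proof -
    have "emeasure M {..<r} = emeasure (density lborel F) (ball 0 r)"
      unfolding M_def by (subst emeasure_distr) (auto intro!: arg_cong[where f = "emeasure _"])
    also have "\<dots> = (\<integral>\<^sup>+x. F x * indicator (ball 0 r) x \<partial>lborel)"
      by (simp add: emeasure_density)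
    finally show ?thesis
      using nn_integral_ball_homogeneous[of F r] by (auto simp: F V_def ball_empty not_less)
  qed
  have N: "emeasure N {..<r} = (if 0 < r then ennreal (r ^ ?d) * V else 0)" for r
  proof (cases "0 < r")
    case True
    have "emeasure N {..<r} = (\<integral>\<^sup>+t. V * (ennreal (?d * t ^ (?d - 1)) * indicator {0..r} t) \<partial>lborel)"
      unfolding N_def using AE_lborel_singleton[of r]
      by (subst emeasure_density) (auto intro!: nn_integral_cong_AE elim!: eventually_mono simp: indicator_def)
    also have "\<dots> = V * (\<integral>\<^sup>+t. ennreal (?d * t ^ (?d - 1)) * indicator {0..r} t \<partial>lborel)"
      by (rule nn_integral_cmult) simp
    also have "(\<integral>\<^sup>+t. ennreal (?d * t ^ (?d - 1)) * indicator {0..r} t \<partial>lborel) = ennreal (r ^ ?d - 0 ^ ?d)"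
      using True by (intro nn_integral_FTC_Icc) (auto intro!: derivative_eq_intros)
    finally show ?thesis using True by (simp add: mult.commute power_0_left)
  next
    case False
    have "emeasure N {..<r} = (\<integral>\<^sup>+t. V * (ennreal (?d * t ^ (?d - 1)) * indicator {0..} t) * indicator {..<r} t \<partial>lborel)"
      unfolding N_def by (rule emeasure_density) auto
    also have "\<dots> = (\<integral>\<^sup>+t. 0 \<partial>(lborel :: real measure))"
      using False by (intro nn_integral_cong) (auto simp: indicator_def)
    finally show ?thesis using False by simp
  qed
  have "M = N"
  proof (rule measure_eqI_generator_eq[where E = "range lessThan" and \<Omega> = UNIV and A = "\<lambda>i::nat. {..<real i}"])
    show "Int_stable (range (lessThan :: real \<Rightarrow> _))"
    proof (rule Int_stableI)
      fix A B assume "A \<in> range (lessThan :: real \<Rightarrow> _)" "B \<in> range (lessThan :: real \<Rightarrow> _)"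
      then obtain a b :: real where "A = {..<a}" "B = {..<b}" by blast
      then have "A \<inter> B = {..<min a b}" by auto
      then show "A \<inter> B \<in> range lessThan" by blast
    qed
    show "sets M = sigma_sets UNIV (range lessThan)" "sets N = sigma_sets UNIV (range lessThan)"
      by (simp_all add: M_def N_def borel_Iio)
    show "(\<Union>i. {..<real i}) = UNIV"
      by (auto intro: reals_Archimedean2)
    show "emeasure M {..<real i} \<noteq> \<infinity>" for i
      using fin unfolding M V_def[symmetric] by (auto simp: ennreal_mult_eq_top_iff)
    show "emeasure M X = emeasure N X" if "X \<in> range lessThan" for X
      using that M N by auto
  qed auto
  have "(\<integral>\<^sup>+x. F x * h (norm x) \<partial>lborel) = (\<integral>\<^sup>+t. h t \<partial>M)"
    unfolding M_def by (simp add: nn_integral_distr nn_integral_density)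
  also have "\<dots> = (\<integral>\<^sup>+t. V * (ennreal (?d * t ^ (?d - 1)) * h t * indicator {0..} t) \<partial>lborel)"
    unfolding \<open>M = N\<close> N_def by (simp add: nn_integral_density mult_ac)
  also have "\<dots> = V * (\<integral>\<^sup>+t. ennreal (?d * t ^ (?d - 1)) * h t * indicator {0..} t \<partial>lborel)"
    by (rule nn_integral_cmult) simp
  finally show ?thesis by (simp add: V_def)
qed

lemma nn_integral_uniform_sphere:
  fixes f :: "'a::euclidean_space \<Rightarrow> ennreal"
  assumes [measurable]: "f \<in> borel_measurable borel"
  shows "(\<integral>\<^sup>+x. f (x /\<^sub>R norm x) * indicator (ball 0 1) x \<partial>lborel)
     = emeasure lborel (ball (0::'a) 1) * (\<integral>\<^sup>+u. f u \<partial>uniform_sphere)"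
proof -
  have "(\<integral>\<^sup>+u. f u \<partial>uniform_sphere) = (\<integral>\<^sup>+x. f (x /\<^sub>R norm x) * indicator (ball 0 1) x \<partial>lborel) / emeasure lborel (ball (0::'a) 1)"
    unfolding uniform_sphere_def by (simp add: nn_integral_distr nn_integral_uniform_measure)
  moreover have "e * (I / e) = I" if "e \<noteq> 0" "e \<noteq> \<infinity>" for e I :: ennreal
    unfolding ennreal_times_divide mult.commute[of e I] using that by (intro mult_divide_eq_ennreal) auto
  ultimately show ?thesis
    using emeasure_unit_ball_pos_finite[where 'a = 'a] by simp
qed

text \<open>Direction and length of a Gaussian vector are independent and the direction is uniform; the
  Gamma quotient is the moment of the length. The normalizing constant comes from the case of the
  constant function 1 with \<open>m = 0\<close>.\<close>
lemma gaussian_polar: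
  fixes f :: "'a::euclidean_space \<Rightarrow> ennreal"
  assumes [measurable]: "f \<in> borel_measurable borel" and fin: "(\<integral>\<^sup>+u. f u \<partial>uniform_sphere) < \<infinity>"
  shows "(\<integral>\<^sup>+x. f (x /\<^sub>R norm x) * ennreal (norm x ^ m) \<partial>gaussian)
     = (\<integral>\<^sup>+u. f u \<partial>uniform_sphere) * ennreal (Gamma ((real DIM('a) + real m) / 2) / Gamma (real DIM('a) / 2))"
proof -
  let ?d = "DIM('a)"
  define C where "C = emeasure lborel (ball (0::'a) 1) * ennreal (?d / (2 * sqrt pi ^ ?d))"
  have C: "(\<integral>\<^sup>+x. g (x /\<^sub>R norm x) * ennreal (norm x ^ m) \<partial>gaussian) =
      (\<integral>\<^sup>+u. g u \<partial>uniform_sphere) * (C * ennreal (Gamma ((real ?d + real m) / 2)))"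
    if [measurable]: "g \<in> borel_measurable borel" and fin: "(\<integral>\<^sup>+u. g u \<partial>uniform_sphere) < \<infinity>"
    for g :: "'a \<Rightarrow> ennreal" and m
  proof -
    let ?h = "\<lambda>t. ennreal (t ^ m * exp (- t\<^sup>2) / sqrt pi ^ ?d)"
    have g: "g ((c *\<^sub>R x) /\<^sub>R norm (c *\<^sub>R x)) = g (x /\<^sub>R norm x)" if "0 < c" for c x
    proof -
      have "inverse (c * norm x) * c = inverse (norm x)" using that by (simp add: divide_simps)
      then have "(c *\<^sub>R x) /\<^sub>R norm (c *\<^sub>R x) = x /\<^sub>R norm x"
        by (simp only: norm_scaleR abs_of_pos[OF that] scaleR_scaleR)
      then show ?thesis by (simp only:)
    qed
    have comb: "ennreal p * (G * ennreal q) = G * ennreal (q * p)" if "0 \<le> p" "0 \<le> q" for p q G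
      using that by (simp add: ennreal_mult' mult_ac)
    have "(\<integral>\<^sup>+x. g (x /\<^sub>R norm x) * ennreal (norm x ^ m) \<partial>gaussian)
       = (\<integral>\<^sup>+x. g (x /\<^sub>R norm x) * ?h (norm x) \<partial>lborel)"
      unfolding gaussian_def
      by (subst nn_integral_density) (auto intro!: nn_integral_cong simp: comb)
    also have "\<dots> = (\<integral>\<^sup>+x. g (x /\<^sub>R norm x) * indicator (ball 0 1) x \<partial>lborel) *
       (\<integral>\<^sup>+t. ennreal (?d * t ^ (?d - 1)) * ?h t * indicator {0..} t \<partial>lborel)"
      using fin emeasure_unit_ball_pos_finite(2)[where 'a = 'a]
      by (intro nn_integral_polar g) (auto simp: nn_integral_uniform_sphere ennreal_mult_less_top less_top)
    also have "(\<integral>\<^sup>+t. ennreal (?d * t ^ (?d - 1)) * ?h t * indicator {0..} t \<partial>lborel)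
       = (\<integral>\<^sup>+t. ennreal (?d / sqrt pi ^ ?d) * (ennreal (t ^ (?d - 1 + m) * exp (- t\<^sup>2)) * indicator {0..} t) \<partial>lborel)"
      unfolding power_add by (intro nn_integral_cong) (auto simp: indicator_def mult_ac ennreal_mult'[symmetric])
    also have "\<dots> = ennreal (?d / sqrt pi ^ ?d) * ennreal (Gamma ((real (?d - 1 + m) + 1) / 2) / 2)"
      by (subst nn_integral_cmult) (simp_all add: nn_integral_gaussian_moment)
    also have "(real (?d - 1 + m) + 1) / 2 = (real ?d + real m) / 2"
      by (simp add: of_nat_diff Suc_leI)
    also have "ennreal (?d / sqrt pi ^ ?d) * ennreal (Gamma ((real ?d + real m) / 2) / 2) =
       ennreal (?d / (2 * sqrt pi ^ ?d)) * ennreal (Gamma ((real ?d + real m) / 2))"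
      by (simp add: ennreal_mult'[symmetric]) (simp add: mult.commute)
    finally show ?thesis
      unfolding nn_integral_uniform_sphere[OF that(1)] C_def by (simp add: mult_ac)
  qed
  interpret S: prob_space "uniform_sphere :: 'a measure" by (rule prob_space_uniform_sphere)
  interpret G: prob_space "gaussian :: 'a measure" by (rule prob_space_gaussian)
  have G0: "0 < Gamma (real ?d / 2)" by (intro Gamma_real_pos) simp
  have "1 = C * ennreal (Gamma (real ?d / 2))"
    using C[of "\<lambda>_. 1" 0] S.emeasure_space_1 G.emeasure_space_1 by simp
  then have "C = ennreal (1 / Gamma (real ?d / 2))"
    using G0 by (metis divide_ennreal ennreal_1 ennreal_divide_self ennreal_neq_top ennreal_eq_0_iff less_imp_le mult_divide_eq_ennreal not_le zero_le_one)
  then show ?thesis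
    unfolding C[OF assms] using G0 by (simp add: ennreal_mult'[symmetric])
qed

text \<open>A Mellin integral that produces negative powers of \<open>w\<close> from \<open>exp (- s\<^sup>2 * w / 4)\<close>.\<close>
lemma nn_integral_scaled_gaussian_moment:
  assumes w: "0 < w"
  shows "(\<integral>\<^sup>+s. ennreal (s ^ (2 * k + 1) * exp (- s\<^sup>2 * w / 4)) * indicator {0..} s \<partial>lborel)
    = ennreal ((1 / w) ^ Suc k) * ennreal (4 ^ Suc k * fact k / 2)"
proof -
  \<comment> \<open>the substitution \<open>s = q * t\<close> turns the exponent into \<open>- t\<^sup>2\<close>\<close>
  define q where "q = 2 / sqrt w"
  have q: "0 < q" using w by (simp add: q_def)
  have q2: "q * q = 4 / w" using w by (simp add: q_def)
  have qe: "(0 + q * t) ^ (2 * k + 1) * exp (- (0 + q * t)\<^sup>2 * w / 4) = q ^ (2 * k + 1) * (t ^ (2 * k + 1) * exp (- t\<^sup>2))" for t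
  proof -
    have "(q * t)\<^sup>2 * w / 4 = (q * q) * w / 4 * t\<^sup>2" by (simp add: power2_eq_square)
    also have "\<dots> = t\<^sup>2" using w by (simp add: q2)
    finally have "- (0 + q * t)\<^sup>2 * w / 4 = - t\<^sup>2" by simp
    then show ?thesis by (simp only: power_mult_distrib add_0 mult.assoc)
  qed
  have qp: "q * q ^ (2 * k + 1) = (4 / w) ^ Suc k"
    unfolding q2[symmetric] by (simp add: power_mult power2_eq_square power_mult_distrib)
  have "(\<integral>\<^sup>+s. ennreal (s ^ (2 * k + 1) * exp (- s\<^sup>2 * w / 4)) * indicator {0..} s \<partial>lborel) =
    ennreal q * (\<integral>\<^sup>+t. ennreal ((0 + q * t) ^ (2 * k + 1) * exp (- (0 + q * t)\<^sup>2 * w / 4)) * indicator {0..} (0 + q * t) \<partial>lborel)"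
    using q by (subst nn_integral_real_affine[where c = q and t = 0]) auto
  also have "\<dots> = (\<integral>\<^sup>+t. ennreal ((4 / w) ^ Suc k) * (ennreal (t ^ (2 * k + 1) * exp (- t\<^sup>2)) * indicator {0..} t) \<partial>lborel)"
    unfolding qp[symmetric] qe using q
    by (subst nn_integral_cmult[symmetric]) (auto intro!: nn_integral_cong simp: indicator_def
        ennreal_mult'[symmetric] zero_le_mult_iff mult_ac)
  also have "\<dots> = ennreal ((4 / w) ^ Suc k) * ennreal (fact k / 2)"
    by (subst nn_integral_cmult) (simp_all only: nn_integral_gaussian_moment, auto simp: Gamma_fact add_divide_distrib)
  also have "\<dots> = ennreal ((1 / w) ^ Suc k) * ennreal (4 ^ Suc k * fact k / 2)"
    using w by (simp add: ennreal_mult'[symmetric] power_divide)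
  finally show ?thesis .
qed

lemma inner_hyperplane_field_self:
  assumes "\<And>j. a j \<bullet> x \<noteq> 0" "(\<Sum>j\<in>UNIV. c $ j) = 1"
  shows "hyperplane_field a c x \<bullet> x = 1"
  using assms by (simp add: inner_hyperplane_field)

text \<open>Multiplying the transform \<open>E exp (- s\<^sup>2 \<parallel>g(X)\<parallel>\<^sup>2 / 4) = exp (- s)\<close> by an odd power of \<open>s\<close> and
  integrating over \<open>s\<close> gives the moments.\<close>
lemma gaussian_moments_field:
  fixes c :: "real^'k::finite" and a :: "'k \<Rightarrow> real^'p::finite"
  assumes c: "\<And>j. 0 \<le> c $ j" "(\<Sum>j\<in>UNIV. c $ j) = 1" and a: "\<And>j. a j \<noteq> 0"
  shows "(\<integral>\<^sup>+x. ennreal ((1 / (norm (hyperplane_field a c x))\<^sup>2) ^ n) \<partial>gaussian) = ennreal (Gamma (real n + 1/2) / sqrt pi)"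
proof (cases n)
  case 0
  interpret G: prob_space "gaussian :: (real^'p) measure" by (rule prob_space_gaussian)
  show ?thesis using G.emeasure_space_1 by (simp add: 0 Gamma_one_half_real)
next
  case (Suc k)
  let ?G = "gaussian :: (real^'p) measure"
  let ?W = "\<lambda>x. (norm (hyperplane_field a c x))\<^sup>2"
  interpret G: prob_space ?G by (rule prob_space_gaussian)
  interpret P: pair_sigma_finite "lborel :: real measure" ?G ..
  define A where "A = (4 ^ Suc k * fact k / 2 :: real)"
  have A: "A > 0" by (simp add: A_def)
  have "AE x in ?G. \<forall>j. a j \<bullet> x \<noteq> 0"
    by (intro eventually_all_finite AE_gaussian AE_lborel_inner_nonzero a)
  then have pos: "AE x in ?G. 0 < ?W x"
  proof eventually_elim
    fix x assume "\<forall>j. a j \<bullet> x \<noteq> 0"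
    then have "hyperplane_field a c x \<bullet> x = 1" by (intro inner_hyperplane_field_self c) auto
    then show "0 < ?W x" by auto
  qed
  have meas: "(\<lambda>(s, x). ennreal (s ^ (2 * k + 1) * exp (- s\<^sup>2 * ?W x / 4)) * indicator {0..} s) \<in> borel_measurable (lborel \<Otimes>\<^sub>M ?G)"
    by measurable
  have "(\<integral>\<^sup>+x. ennreal ((1 / ?W x) ^ n) \<partial>?G) * ennreal A = (\<integral>\<^sup>+x. ennreal ((1 / ?W x) ^ Suc k) * ennreal A \<partial>?G)"
    by (simp add: nn_integral_multc Suc)
  also have "\<dots> = (\<integral>\<^sup>+x. (\<integral>\<^sup>+s. ennreal (s ^ (2 * k + 1) * exp (- s\<^sup>2 * ?W x / 4)) * indicator {0..} s \<partial>lborel) \<partial>?G)"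
    using pos by (intro nn_integral_cong_AE, eventually_elim) (simp only: nn_integral_scaled_gaussian_moment A_def)
  also have "\<dots> = (\<integral>\<^sup>+s. (\<integral>\<^sup>+x. ennreal (s ^ (2 * k + 1) * exp (- s\<^sup>2 * ?W x / 4)) * indicator {0..} s \<partial>?G) \<partial>lborel)"
    using P.Fubini[OF meas] by simp
  also have "\<dots> = (\<integral>\<^sup>+s. ennreal (s ^ (2 * k + 1) * exp (- s)) * indicator {0..} s \<partial>lborel)"
  proof (rule nn_integral_cong)
    fix s :: real
    show "(\<integral>\<^sup>+x. ennreal (s ^ (2 * k + 1) * exp (- s\<^sup>2 * ?W x / 4)) * indicator {0..} s \<partial>?G) = ennreal (s ^ (2 * k + 1) * exp (- s)) * indicator {0..} s"
    proof (cases "0 \<le> s")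
      case True
      have "integrable ?G (\<lambda>x. exp (- s\<^sup>2 * ?W x / 4))"
        by (rule G.integrable_const_bound[where B = 1]) auto
      then have "(\<integral>\<^sup>+x. ennreal (exp (- s\<^sup>2 * ?W x / 4)) \<partial>?G) = ennreal (exp (- s))"
        using gaussian_transform_field[OF c a True] by (subst nn_integral_eq_integral) auto
      then show ?thesis
        using True by (simp add: ennreal_mult' nn_integral_cmult)
    qed simp
  qed
  also have "\<dots> = ennreal (fact (2 * k + 1))"
    using nn_intergal_power_times_exp_Ici[of "2 * k + 1"] by (simp only: of_nat_fact)
  finally have eq: "(\<integral>\<^sup>+x. ennreal ((1 / ?W x) ^ n) \<partial>?G) * ennreal A = ennreal (fact (2 * k + 1))" .
  have "Gamma (real n + 1/2) / sqrt pi = fact (2 * k + 1) / A"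
  proof -
    have "fact (2 * Suc k) = 2 * (real k + 1) * fact (2 * k + 1)" "fact (Suc k) = (real k + 1) * fact k"
      by (simp_all add: algebra_simps)
    moreover have "(2::real) ^ (2 * Suc k) = 4 ^ Suc k"
      by (subst power_mult) simp
    ultimately have "Gamma (real n + 1/2) / sqrt pi = (2 * (real k + 1) * fact (2 * k + 1)) / (4 ^ Suc k * ((real k + 1) * fact k))"
      unfolding Gamma_half_nat Suc by (simp only:) simp
    also have "\<dots> = fact (2 * k + 1) / A"
    proof -
      have "(2 * u * x) / (y * (u * z)) = x / (y * z / 2)" if "u \<noteq> 0" for u x y z :: real
        using that by simp
      then show ?thesis unfolding A_def by (metis of_nat_Suc of_nat_neq_0 add.commute)
    qed
    finally show ?thesis .
  qed
  then have "(\<integral>\<^sup>+x. ennreal ((1 / ?W x) ^ n) \<partial>?G) * ennreal A = ennreal (Gamma (real n + 1/2) / sqrt pi) * ennreal A"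
    using eq A by (simp add: ennreal_mult'[symmetric])
  then show ?thesis
    using A by (metis ennreal_eq_0_iff ennreal_neq_top mult_divide_eq_ennreal not_le)
qed

section \<open>The Beta law\<close>

text \<open>On \<open>[0, 1]\<close> all moments are at most 1, so the Taylor polynomials of the characteristic function
  converge to it, and their coefficients are the moments.\<close>
lemma real_distribution_eqI_moments:
  assumes M: "real_distribution M" and N: "real_distribution N"
    and M01: "AE x in M. 0 \<le> x \<and> x \<le> 1" and N01: "AE x in N. 0 \<le> x \<and> x \<le> 1"
    and mom: "\<And>n. (\<integral>\<^sup>+x. ennreal (x ^ n) \<partial>M) = (\<integral>\<^sup>+x. ennreal (x ^ n) \<partial>N)"
  shows "M = N"
proof (rule Levy_uniqueness[OF M N], rule ext)
  fix t :: real
  have int: "integrable K (\<lambda>x. x ^ n)" if "real_distribution K" "AE x in K. 0 \<le> x \<and> x \<le> 1" for K :: "real measure" and n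
  proof -
    interpret K: real_distribution K by fact
    have "AE x in K. norm (x ^ n) \<le> 1"
      using that(2) by eventually_elim (simp add: power_le_one)
    then show ?thesis by (rule K.integrable_const_bound) simp
  qed
  have ex: "integral\<^sup>L K (\<lambda>x. x ^ n) = enn2real (\<integral>\<^sup>+x. ennreal (x ^ n) \<partial>K)"
    if "real_distribution K" "AE x in K. 0 \<le> x \<and> x \<le> 1" for K :: "real measure" and n
    using that(2) int[OF that, of n] by (intro integral_eq_nn_integral) (auto elim!: eventually_mono)
  have le1: "integral\<^sup>L K (\<lambda>x. \<bar>x\<bar> ^ n) \<le> 1"
    if "real_distribution K" "AE x in K. 0 \<le> x \<and> x \<le> 1" for K :: "real measure" and n
  proof -
    interpret K: real_distribution K by fact
    have "AE x in K. \<bar>x\<bar> ^ n \<le> 1"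
      using that(2) by eventually_elim (simp add: power_le_one)
    then have "integral\<^sup>L K (\<lambda>x. \<bar>x\<bar> ^ n) \<le> integral\<^sup>L K (\<lambda>x. 1)"
      using integrable_abs[OF int[OF that, of n]] by (intro integral_mono_AE) (auto simp: power_abs)
    then show ?thesis using K.prob_space by simp
  qed
  define S where "S n = (\<Sum>k\<le>n. ((\<i> * t) ^ k / fact k) * integral\<^sup>L M (\<lambda>x. x ^ k))" for n
  have S2: "S n = (\<Sum>k\<le>n. ((\<i> * t) ^ k / fact k) * integral\<^sup>L N (\<lambda>x. x ^ k))" for n
    unfolding S_def ex[OF M M01] ex[OF N N01] mom ..
  have lim: "(\<lambda>n. 2 * \<bar>t\<bar> ^ n / fact n) \<longlonglongrightarrow> 0"
    using tendsto_mult_right_zero[OF summable_LIMSEQ_zero[OF summable_exp[of "\<bar>t\<bar>"]], of 2] by (simp add: field_simps)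
  have "S \<longlonglongrightarrow> char K t"
    if K: "real_distribution K" "AE x in K. 0 \<le> x \<and> x \<le> 1"
      and SK: "\<And>n. S n = (\<Sum>k\<le>n. ((\<i> * t) ^ k / fact k) * integral\<^sup>L K (\<lambda>x. x ^ k))" for K
  proof -
    have "cmod (char K t - S n) \<le> 2 * \<bar>t\<bar> ^ n / fact n" for n
    proof -
      have "cmod (char K t - S n) \<le> (2 * \<bar>t\<bar> ^ n / fact n) * integral\<^sup>L K (\<lambda>x. \<bar>x\<bar> ^ n)"
        unfolding SK by (rule real_distribution.char_approx1[OF K(1)]) (rule int[OF K])
      also have "\<dots> \<le> (2 * \<bar>t\<bar> ^ n / fact n) * 1"
        by (intro mult_left_mono le1 K) simp
      finally show ?thesis by simp
    qed
    then have "(\<lambda>n. S n - char K t) \<longlonglongrightarrow> 0"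
      by (intro Lim_null_comparison[OF _ lim]) (simp add: norm_minus_commute)
    then show ?thesis by (rule LIM_zero_cancel)
  qed
  from this[OF M M01 S_def] this[OF N N01 S2] show "char M t = char N t"
    by (rule LIMSEQ_unique)
qed

lemma beta_density_nonneg: "0 < a \<Longrightarrow> 0 < b \<Longrightarrow> 0 \<le> beta_density a b x"
  by (auto simp: beta_density_def Beta_def intro!: divide_nonneg_nonneg mult_nonneg_nonneg)

lemma borel_measurable_beta_density [measurable]: "beta_density a b \<in> borel_measurable borel"
  unfolding beta_density_def[abs_def] by measurable

text \<open>A factor \<open>x\<^sup>n\<close> raises the first Beta parameter by \<open>n\<close>.\<close>
lemma beta_moments:
  assumes a: "0 < a" and b: "0 < b"
  shows "(\<integral>\<^sup>+x. ennreal (x ^ n) \<partial>density lborel (beta_density a b)) = ennreal (Beta (a + n) b / Beta a b)"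
proof -
  have B: "0 < Beta a b" using a b by (auto simp: Beta_def intro!: divide_pos_pos mult_pos_pos)
  have "((\<lambda>t. t powr (a + n - 1) * (1 - t) powr (b - 1)) has_integral Beta (a + n) b) {0..1}"
    using a b by (intro has_integral_Beta_real) auto
  then have hi: "((\<lambda>t. t powr (a + n - 1) * (1 - t) powr (b - 1) / Beta a b) has_integral Beta (a + n) b / Beta a b) {0..1}"
    by (rule has_integral_divide)
  have "(\<integral>\<^sup>+x. ennreal (x ^ n) \<partial>density lborel (beta_density a b)) = (\<integral>\<^sup>+x. ennreal (beta_density a b x) * ennreal (x ^ n) \<partial>lborel)"
    by (subst nn_integral_density) auto
  also have "\<dots> = (\<integral>\<^sup>+x. ennreal (indicator {0..1} x * (x powr (a + n - 1) * (1 - x) powr (b - 1) / Beta a b)) \<partial>lborel)"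
  proof (rule nn_integral_cong_AE)
    show "AE x in lborel. ennreal (beta_density a b x) * ennreal (x ^ n) = ennreal (indicator {0..1} x * (x powr (a + n - 1) * (1 - x) powr (b - 1) / Beta a b))"
      using AE_lborel_singleton[of 0] AE_lborel_singleton[of 1]
    proof eventually_elim
      fix x :: real assume x: "x \<noteq> 0" "x \<noteq> 1"
      show "ennreal (beta_density a b x) * ennreal (x ^ n) = ennreal (indicator {0..1} x * (x powr (a + n - 1) * (1 - x) powr (b - 1) / Beta a b))"
      proof (cases "0 < x \<and> x < 1")
        case True
        then have "x powr (a + n - 1) = x powr (a - 1) * x ^ n"
          by (simp add: powr_realpow[symmetric] powr_add[symmetric] algebra_simps)
        then show ?thesis
          using True beta_density_nonneg[OF a b, of x]
          by (simp add: ennreal_mult'[symmetric] beta_density_def mult_ac)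
      next
        case False
        then show ?thesis using x by (auto simp: beta_density_def indicator_def)
      qed
    qed
  qed
  also have "\<dots> = ennreal (Beta (a + n) b / Beta a b)"
    using B by (intro nn_integral_has_integral_lebesgue[OF _ hi]) auto
  finally show ?thesis .
qed

lemma real_distribution_beta:
  assumes "0 < a" "0 < b" shows "real_distribution (density lborel (beta_density a b))"
proof -
  have "Beta a b > 0" using assms by (auto simp: Beta_def intro!: divide_pos_pos mult_pos_pos)
  then have "prob_space (density lborel (beta_density a b))"
    using beta_moments[OF assms, of 0] by (intro prob_spaceI) simp
  then show ?thesis by (simp add: real_distribution_def real_distribution_axioms_def)
qed

lemma AE_beta: "AE x in density lborel (\<lambda>x. ennreal (beta_density a b x)). 0 \<le> x \<and> x \<le> 1"
  by (subst AE_density) (auto simp: beta_density_def split: if_splits)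

lemma AE_uniform_sphere_inner_nonzero:
  fixes a :: "'a::euclidean_space"
  assumes a: "a \<noteq> 0" shows "AE u in uniform_sphere. a \<bullet> u \<noteq> 0"
proof -
  have "AE x in uniform_measure lborel (ball (0::'a) 1). a \<bullet> x \<noteq> 0"
    using AE_lborel_inner_nonzero[OF a] by (intro AE_uniform_measureI) auto
  then have "AE x in uniform_measure lborel (ball (0::'a) 1). a \<bullet> (x /\<^sub>R norm x) \<noteq> 0"
    by (rule eventually_mono) auto
  then show ?thesis
    unfolding uniform_sphere_def by (subst AE_distr_iff) auto
qed


lemma hyperplane_field_scale: "hyperplane_field a c (r *\<^sub>R x) = hyperplane_field a c x /\<^sub>R r"
  by (simp add: hyperplane_field_def scaleR_sum_right mult_ac)

text \<open>By homogeneity \<open>1 / \<parallel>g(x)\<parallel>\<^sup>2\<close> is the product of \<open>\<parallel>x\<parallel>\<^sup>2\<close> and its value at the direction of \<open>x\<close>;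
  these factors are independent under the Gaussian law, so the moments divide.\<close>
lemma sphere_moments_field:
  fixes c :: "real^'k::finite" and a :: "'k \<Rightarrow> real^'p::finite"
  assumes c: "\<And>j. 0 \<le> c $ j" "(\<Sum>j\<in>UNIV. c $ j) = 1" and a: "\<And>j. a j \<noteq> 0"
    and fin: "(\<integral>\<^sup>+u. ennreal ((1 / (norm (hyperplane_field a c u))\<^sup>2) ^ n) \<partial>uniform_sphere) < \<infinity>"
  shows "(\<integral>\<^sup>+u. ennreal ((1 / (norm (hyperplane_field a c u))\<^sup>2) ^ n) \<partial>uniform_sphere)
    = ennreal (Gamma (1/2 + real n) * Gamma (real CARD('p) / 2) / (sqrt pi * Gamma (real CARD('p) / 2 + real n)))"
    (is "?I = _")
proof -
  let ?M = "\<lambda>x. 1 / (norm (hyperplane_field a c x))\<^sup>2"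
  define R where "R = Gamma (real CARD('p) / 2 + real n) / Gamma (real CARD('p) / 2)"
  have R: "0 < R" unfolding R_def by (intro divide_pos_pos Gamma_real_pos add_pos_nonneg) auto
  have M: "?M x = (norm x)\<^sup>2 * ?M (x /\<^sub>R norm x)" for x
    by (cases "x = 0") (simp_all add: hyperplane_field_scale power_mult_distrib power_divide,
       simp add: hyperplane_field_def)
  have pw: "?M x ^ n = ?M (x /\<^sub>R norm x) ^ n * norm x ^ (2 * n)" for x
    by (subst M) (simp add: power_mult_distrib power_mult[symmetric] mult.commute power_divide)
  have "(\<integral>\<^sup>+x. ennreal (?M x ^ n) \<partial>gaussian)
     = (\<integral>\<^sup>+x. ennreal (?M (x /\<^sub>R norm x) ^ n) * ennreal (norm x ^ (2 * n)) \<partial>gaussian)"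
  proof (rule nn_integral_cong)
    fix x
    show "ennreal (?M x ^ n) = ennreal (?M (x /\<^sub>R norm x) ^ n) * ennreal (norm x ^ (2 * n))"
      unfolding pw[of x] by (rule ennreal_mult) auto
  qed
  also have "\<dots> = ?I * ennreal (Gamma ((real DIM(real^'p) + real (2 * n)) / 2) / Gamma (real DIM(real^'p) / 2))"
    by (rule gaussian_polar) (use fin in auto)
  also have "Gamma ((real DIM(real^'p) + real (2 * n)) / 2) / Gamma (real DIM(real^'p) / 2) = R"
    by (simp add: R_def add_divide_distrib)
  finally have "?I * ennreal R = ennreal (Gamma (1/2 + real n) / sqrt pi)"
    using gaussian_moments_field[OF c a, where n = n] by (simp add: add.commute)
  then have "?I = ennreal (Gamma (1/2 + real n) / sqrt pi) / ennreal R"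
    using R by (metis ennreal_eq_0_iff ennreal_neq_top mult_divide_eq_ennreal not_le)
  also have "\<dots> = ennreal (Gamma (1/2 + real n) * Gamma (real CARD('p) / 2) / (sqrt pi * Gamma (real CARD('p) / 2 + real n)))"
    using R by (subst divide_ennreal) (auto simp: R_def intro!: divide_nonneg_nonneg Gamma_real_nonneg)
  finally show ?thesis .
qed

text \<open>The relation \<open>g(u) \<bullet> u = 1\<close> on the unit sphere forces \<open>\<parallel>g(u)\<parallel> \<ge> 1\<close>, which makes the law
  determinate by its moments.\<close>
lemma beta_universal_if_nonneg:
  fixes c :: "real^'k::finite"
  assumes p: "2 \<le> CARD('p::finite)" and c: "\<And>j. 0 \<le> c $ j" "(\<Sum>j\<in>UNIV. c $ j) = 1"
  shows "beta_universal TYPE('p) c"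
  unfolding beta_universal_def distributed_def
proof (intro allI impI conjI)
  fix a :: "'k \<Rightarrow> real^'p" assume a: "\<forall>j. a j \<noteq> 0"
  let ?M = "\<lambda>x. 1 / (norm (hyperplane_field a c x))\<^sup>2"
  let ?b = "(real CARD('p) - 1) / 2"
  interpret prob_space "uniform_sphere :: (real^'p) measure" by (rule prob_space_uniform_sphere)
  have b: "0 < ?b" using p by simp
  show "?M \<in> measurable uniform_sphere lborel" by simp
  show "(\<lambda>x. ennreal (beta_density (1 / 2) ?b x)) \<in> borel_measurable lborel" by simp
  have "AE u in (uniform_sphere :: (real^'p) measure). \<forall>j. a j \<bullet> u \<noteq> 0"
    using a by (intro eventually_all_finite AE_uniform_sphere_inner_nonzero) auto
  then have M01: "AE u in uniform_sphere. 0 \<le> ?M u \<and> ?M u \<le> 1"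
    using AE_uniform_sphere
  proof eventually_elim
    fix u :: "real^'p" assume nz: "\<forall>j. a j \<bullet> u \<noteq> 0" and u: "u \<in> sphere 0 1"
    have "1 = hyperplane_field a c u \<bullet> u"
      using inner_hyperplane_field_self[of a u c] nz c by simp
    also have "\<dots> \<le> norm (hyperplane_field a c u) * norm u"
      by (rule norm_cauchy_schwarz)
    finally have "1 \<le> norm (hyperplane_field a c u)" using u by simp
    then have "1 \<le> (norm (hyperplane_field a c u))\<^sup>2" by (rule one_le_power)
    then show "0 \<le> ?M u \<and> ?M u \<le> 1" by (simp add: divide_le_eq_1)
  qed
  have "distr uniform_sphere borel ?M = density lborel (beta_density (1/2) ?b)"
  proof (rule real_distribution_eqI_moments)
    show "real_distribution (distr uniform_sphere borel ?M)"
      by (rule real_distribution_distr) simp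
    show "real_distribution (density lborel (beta_density (1/2) ?b))"
      using b by (intro real_distribution_beta) auto
    show "AE x in distr uniform_sphere borel ?M. 0 \<le> x \<and> x \<le> 1"
      using M01 by (subst AE_distr_iff) auto
    show "AE x in density lborel (beta_density (1/2) ?b). 0 \<le> x \<and> x \<le> 1"
      by (rule AE_beta)
    fix n
    have "(\<integral>\<^sup>+u. ennreal (?M u ^ n) \<partial>uniform_sphere) \<le> (\<integral>\<^sup>+u. 1 \<partial>(uniform_sphere :: (real^'p) measure))"
      using M01 by (intro nn_integral_mono_AE, eventually_elim) (simp add: power_le_one del: power_one_over)
    then have fin: "(\<integral>\<^sup>+u. ennreal (?M u ^ n) \<partial>uniform_sphere) < \<infinity>"
      using emeasure_space_1 by (simp add: le_less_trans)
    have "(\<integral>\<^sup>+x. ennreal (x ^ n) \<partial>distr uniform_sphere borel ?M) = (\<integral>\<^sup>+u. ennreal (?M u ^ n) \<partial>uniform_sphere)"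
      by (subst nn_integral_distr) auto
    also have "\<dots> = ennreal (Gamma (1/2 + real n) * Gamma (real CARD('p) / 2) / (sqrt pi * Gamma (real CARD('p) / 2 + real n)))"
      by (rule sphere_moments_field) (use c a fin in auto)
    also have "Gamma (1/2 + real n) * Gamma (real CARD('p) / 2) / (sqrt pi * Gamma (real CARD('p) / 2 + real n))
        = Beta (1/2 + real n) ?b / Beta (1/2) ?b"
    proof -
      have e: "1/2 + real n + ?b = real CARD('p) / 2 + real n" "1/2 + ?b = real CARD('p) / 2"
        by (simp_all add: field_simps)
      have "Gamma ?b \<noteq> 0" using Gamma_real_pos[OF b] by simp
      then show ?thesis unfolding Beta_def e Gamma_one_half_real by (simp add: field_simps)
    qed
    also have "ennreal \<dots> = (\<integral>\<^sup>+x. ennreal (x ^ n) \<partial>density lborel (beta_density (1/2) ?b))"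
      using b by (subst beta_moments) auto
    finally show "(\<integral>\<^sup>+x. ennreal (x ^ n) \<partial>distr uniform_sphere borel ?M)
       = (\<integral>\<^sup>+x. ennreal (x ^ n) \<partial>density lborel (beta_density (1/2) ?b))" .
  qed
  then show "distr uniform_sphere lborel ?M = density lborel (\<lambda>x. ennreal (beta_density (1 / 2) ?b x))"
    by (simp cong: distr_cong)
qed

section \<open>Negative coefficients\<close>

text \<open>A law with positive density on an interval cannot avoid that interval; both converse directions
  contradict this.\<close>
lemma distributed_no_gap:
  fixes X :: "'a \<Rightarrow> real" and f :: "real \<Rightarrow> real"
  assumes X: "distributed M lborel X (\<lambda>x. ennreal (f x))"
    and ab: "a < b" and pos: "\<And>x. a < x \<Longrightarrow> x < b \<Longrightarrow> 0 < f x"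
    and null: "AE x in M. X x \<notin> {a<..<b}"
  shows False
proof -
  have fm: "(\<lambda>x. ennreal (f x)) \<in> borel_measurable lborel" using X by (rule distributed_borel_measurable)
  have "{x \<in> space lborel. x \<notin> {a<..<b}} \<in> sets lborel"
  proof -
    have "{x \<in> space lborel. x \<notin> {a<..<b}} = - {a<..<b}" by auto
    then show ?thesis by (simp only: sets_lborel) (rule borel_comp, simp)
  qed
  then have "AE x in distr M lborel X. x \<notin> {a<..<b}"
    using null by (subst AE_distr_iff[OF distributed_measurable[OF X]])
  then have "AE x in density lborel (\<lambda>x. ennreal (f x)). x \<notin> {a<..<b}"
    unfolding distributed_distr_eq_density[OF X] .
  then have "AE x in lborel. 0 < ennreal (f x) \<longrightarrow> x \<notin> {a<..<b}"
    by (simp add: AE_density[OF fm])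
  then have "AE x in lborel. x \<notin> {a<..<b}"
    by (rule eventually_mono) (use pos in auto)
  then have "emeasure lborel {a<..<b} = 0"
    by (subst (asm) AE_iff_measurable[where N = "{a<..<b}"]) auto
  then show False using ab by simp
qed

lemma negative_part_split:
  fixes c :: "real^'k::finite"
  assumes neg: "c $ i < 0" and sum: "(\<Sum>j\<in>UNIV. c $ j) = 1"
  obtains m where "0 < m" "(\<Sum>j\<in>{j. 0 \<le> c $ j}. c $ j) = 1 + m" "(\<Sum>j\<in>{j. c $ j < 0}. c $ j) = - m"
proof -
  have "(\<Sum>j\<in>UNIV. c $ j) = (\<Sum>j\<in>{j. 0 \<le> c $ j}. c $ j) + (\<Sum>j\<in>{j. c $ j < 0}. c $ j)"
    by (subst sum.union_disjoint[symmetric]) (auto intro!: sum.cong)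
  moreover have "(\<Sum>j\<in>{j. c $ j < 0}. c $ j) < 0"
  proof -
    have "(\<Sum>j\<in>{j. c $ j < 0}. c $ j) = c $ i + (\<Sum>j\<in>{j. c $ j < 0} - {i}. c $ j)"
      using neg by (intro sum.remove) auto
    moreover have "(\<Sum>j\<in>{j. c $ j < 0} - {i}. c $ j) \<le> 0"
      by (intro sum_nonpos) auto
    ultimately show ?thesis using neg by simp
  qed
  ultimately show ?thesis
    using that[of "- (\<Sum>j\<in>{j. c $ j < 0}. c $ j)"] sum by auto
qed

lemma sum_two_values:
  fixes c :: "real^'k::finite" and v w :: "'v::real_vector"
  shows "(\<Sum>j\<in>UNIV. c $ j *\<^sub>R (if 0 \<le> c $ j then v else w)) =
    (\<Sum>j\<in>{j. 0 \<le> c $ j}. c $ j) *\<^sub>R v + (\<Sum>j\<in>{j. c $ j < 0}. c $ j) *\<^sub>R w"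
proof -
  have "(\<Sum>j\<in>UNIV. c $ j *\<^sub>R (if 0 \<le> c $ j then v else w)) = (\<Sum>j\<in>UNIV. if 0 \<le> c $ j then c $ j *\<^sub>R v else c $ j *\<^sub>R w)"
    by (intro sum.cong) auto
  also have "\<dots> = (\<Sum>j\<in>{j. 0 \<le> c $ j}. c $ j *\<^sub>R v) + (\<Sum>j\<in>{j. c $ j < 0}. c $ j *\<^sub>R w)"
    by (subst sum.If_cases) (auto simp: not_le Collect_neg_eq[symmetric])
  finally show ?thesis by (simp add: scaleR_sum_left)
qed

text \<open>Angle 0 for the nonnegative and \<open>\<pi>/2\<close> for the negative coefficients gives the sum
  \<open>t + m * (t + 1 / t)\<close> with \<open>t = tan \<phi>\<close>, whose modulus exceeds \<open>m\<close>, where \<open>- m\<close> is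
  the sum of the negative coefficients.\<close>
lemma not_cauchy_universal:
  fixes c :: "real^'k::finite"
  assumes neg: "c $ i < 0" and sum: "(\<Sum>j\<in>UNIV. c $ j) = 1"
  shows "\<not> cauchy_universal c"
proof
  assume C: "cauchy_universal c"
  obtain m where m: "0 < m" "(\<Sum>j\<in>{j. 0 \<le> c $ j}. c $ j) = 1 + m" "(\<Sum>j\<in>{j. c $ j < 0}. c $ j) = - m"
    using negative_part_split[OF neg sum] .
  define \<alpha> where "\<alpha> = (\<lambda>j. if 0 \<le> c $ j then 0 else pi / 2)"
  let ?f = "\<lambda>\<phi>. \<Sum>j\<in>UNIV. c $ j * tan (\<phi> - \<alpha> j)"
  have D: "distributed uniform_circle_pi lborel ?f (\<lambda>x. ennreal (cauchy_density 0 1 x))"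
    using C by (simp add: cauchy_universal_def)
  have f: "?f \<phi> = (1 + m) * tan \<phi> - m * tan (\<phi> - pi / 2)" for \<phi>
  proof -
    have "?f \<phi> = (\<Sum>j\<in>UNIV. c $ j *\<^sub>R (if 0 \<le> c $ j then tan \<phi> else tan (\<phi> - pi / 2)))"
      by (intro sum.cong) (auto simp: \<alpha>_def)
    then show ?thesis unfolding sum_two_values m by simp
  qed
  show False
  proof (rule distributed_no_gap[OF D])
    show "-m < m" using m by simp
    show "0 < cauchy_density 0 1 x" for x by (rule cauchy_density_pos)
    show "AE \<phi> in uniform_circle_pi. ?f \<phi> \<notin> {-m<..<m}"
      using AE_uniform_circle_pi_cos[of "\<lambda>_::unit. 0"] AE_uniform_circle_pi_cos[of "\<lambda>_::unit. pi/2"]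
    proof eventually_elim
      fix \<phi> assume c0: "\<forall>j::unit. cos (\<phi> - 0) \<noteq> 0" and s0: "\<forall>j::unit. cos (\<phi> - pi/2) \<noteq> 0"
      define t where "t = tan \<phi>"
      have s: "sin \<phi> \<noteq> 0" using s0 by (simp add: cos_diff)
      have t0: "t \<noteq> 0" using c0 s by (simp add: t_def tan_def)
      have "tan (\<phi> - pi / 2) = - (1 / t)"
        by (simp add: tan_def t_def cos_diff sin_diff)
      then have eq: "?f \<phi> = t + m * (t + 1 / t)" unfolding f by (simp add: t_def algebra_simps)
      have "m < \<bar>t + m * (t + 1 / t)\<bar>"
      proof -
        have "(t + m * (t + 1 / t)) * t = t\<^sup>2 + m * (t\<^sup>2 + 1)"
          using t0 by (simp add: field_simps power2_eq_square)
        then have "\<bar>t + m * (t + 1 / t)\<bar> * \<bar>t\<bar> = t\<^sup>2 + m * (t\<^sup>2 + 1)"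
          using m by (simp flip: abs_mult)
        moreover have "m * \<bar>t\<bar> \<le> m * (t\<^sup>2 + 1)"
        proof (rule mult_left_mono)
          have "0 \<le> (\<bar>t\<bar> - 1)\<^sup>2" by simp
          also have "\<dots> = t\<^sup>2 + 1 - 2 * \<bar>t\<bar>" by (simp add: power2_diff)
          finally show "\<bar>t\<bar> \<le> t\<^sup>2 + 1" by simp
        qed (use m in simp)
        ultimately have "m * \<bar>t\<bar> < \<bar>t + m * (t + 1 / t)\<bar> * \<bar>t\<bar>"
          using t0 by (smt (verit) zero_less_power2)
        then show ?thesis by (simp add: t0 mult_less_cancel_right)
      qed
      then show "?f \<phi> \<notin> {-m<..<m}" unfolding eq by auto
    qed
  qed
qed

text \<open>Two orthogonal axes, one for the nonnegative and one for the negative coefficients, give a field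
  whose component along the first axis has modulus at least \<open>1 + m\<close> on the unit sphere, with \<open>- m\<close>
  the sum of the negative coefficients.\<close>
lemma not_beta_universal:
  fixes c :: "real^'k::finite"
  assumes p: "2 \<le> CARD('p::finite)" and neg: "c $ i < 0" and sum: "(\<Sum>j\<in>UNIV. c $ j) = 1"
  shows "\<not> beta_universal TYPE('p) c"
proof
  assume B: "beta_universal TYPE('p) c"
  obtain m where m: "0 < m" "(\<Sum>j\<in>{j. 0 \<le> c $ j}. c $ j) = 1 + m" "(\<Sum>j\<in>{j. c $ j < 0}. c $ j) = - m"
    using negative_part_split[OF neg sum] .
  obtain p q :: 'p where pq: "p \<noteq> q"
    using p by (metis card_2_iff' card_le_Suc0_iff_eq finite UNIV_I not_less_eq_eq numeral_2_eq_2)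
  define a where "a = (\<lambda>j. if 0 \<le> c $ j then axis p 1 else axis q 1 :: real^'p)"
  let ?X = "\<lambda>u. 1 / (norm (hyperplane_field a c u))\<^sup>2"
  let ?b = "1 / (1 + m)\<^sup>2"
  have a0: "a j \<noteq> 0" for j by (auto simp: a_def axis_eq_0_iff)
  have D: "distributed uniform_sphere lborel ?X (\<lambda>x. ennreal (beta_density (1 / 2) ((real CARD('p) - 1) / 2) x))"
    using B a0 by (simp add: beta_universal_def)
  have axis_neq: "axis p 1 \<noteq> (0 :: real^'p)" by (simp add: axis_eq_0_iff)
  have b: "0 < ?b" "?b < 1" using m by (auto simp: power2_eq_square field_simps add_pos_pos)
  have field: "hyperplane_field a c u = ((1 + m) / u $ p) *\<^sub>R axis p 1 - (m / u $ q) *\<^sub>R axis q 1" for u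
  proof -
    have "hyperplane_field a c u = (\<Sum>j\<in>UNIV. c $ j *\<^sub>R (if 0 \<le> c $ j then axis p 1 /\<^sub>R (u $ p) else axis q 1 /\<^sub>R (u $ q)))"
      unfolding hyperplane_field_def by (intro sum.cong) (auto simp: a_def inner_axis' )
    then show ?thesis unfolding sum_two_values m by (simp add: divide_inverse)
  qed
  show False
  proof (rule distributed_no_gap[OF D])
    show "?b < 1" by (rule b)
    have "0 < (real CARD('p) - 1) / 2" using p by simp
    then have "0 < Beta (1/2) ((real CARD('p) - 1) / 2)"
      unfolding Beta_def by (intro divide_pos_pos mult_pos_pos Gamma_real_pos add_pos_pos) auto
    then show "0 < beta_density (1 / 2) ((real CARD('p) - 1) / 2) x" if "?b < x" "x < 1" for x
    proof -
      have "0 < x" using b that by linarith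
      then show ?thesis using that \<open>0 < Beta _ _\<close> by (simp add: beta_density_def)
    qed
    show "AE u in uniform_sphere. ?X u \<notin> {?b<..<1}"
      using AE_uniform_sphere AE_uniform_sphere_inner_nonzero[of "axis p 1 :: real^'p", OF axis_neq]
    proof eventually_elim
      fix u :: "real^'p"
      assume u: "u \<in> sphere 0 1" and p0: "axis p 1 \<bullet> u \<noteq> 0"
      have up: "0 < \<bar>u $ p\<bar>" "\<bar>u $ p\<bar> \<le> 1"
        using u p0 component_le_norm_cart[of u p] by (auto simp: inner_axis')
      have "1 + m \<le> (1 + m) / \<bar>u $ p\<bar>"
      proof (subst pos_le_divide_eq)
        show "(1 + m) * \<bar>u $ p\<bar> \<le> 1 + m" using up m by (intro mult_left_le) auto
      qed (use up in simp)
      also have "\<dots> = \<bar>hyperplane_field a c u $ p\<bar>"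
        using pq m by (simp add: field axis_def)
      also have "\<dots> \<le> norm (hyperplane_field a c u)"
        by (rule component_le_norm_cart)
      finally have "?X u \<le> ?b"
        using m by (intro divide_left_mono power_mono mult_pos_pos zero_less_power) auto
      then show "?X u \<notin> {?b<..<1}" by auto
    qed
  qed
qed

section \<open>The equivalence\<close>

lemma cauchy_universal_iff:
  fixes c :: "real^'k::finite"
  assumes "(\<Sum>j\<in>UNIV. c $ j) = 1"
  shows "cauchy_universal c \<longleftrightarrow> (\<forall>j. 0 \<le> c $ j)"
  using cauchy_universal_if_nonneg[of c] not_cauchy_universal[of c] assms by (meson not_le)

lemma beta_universal_iff:
  fixes c :: "real^'k::finite"
  assumes "2 \<le> CARD('p::finite)" "(\<Sum>j\<in>UNIV. c $ j) = 1"
  shows "beta_universal TYPE('p) c \<longleftrightarrow> (\<forall>j. 0 \<le> c $ j)"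
  using beta_universal_if_nonneg[of c, where 'p = 'p] not_beta_universal[of c, where 'p = 'p] assms by (meson not_le)

theorem theorem6p5:
  fixes c :: "real^'k::finite"
  assumes "CARD('p::finite) \<ge> 2"
    and "(\<Sum>j\<in>UNIV. c $ j) = 1"
  shows "((\<forall>j. 0 \<le> c $ j) \<longleftrightarrow> beta_universal TYPE('p) c) \<and>
         ((\<forall>j. 0 \<le> c $ j) \<longleftrightarrow> cauchy_universal c) \<and>
         {d :: real^'k. (\<Sum>j\<in>UNIV. d $ j) = 1 \<and> beta_universal TYPE('p) d} = probability_simplex \<and>
         {d :: real^'k. (\<Sum>j\<in>UNIV. d $ j) = 1 \<and> cauchy_universal d} = probability_simplex"
  unfolding probability_simplex_def
  using assms beta_universal_iff[OF assms(1), where 'k = 'k] cauchy_universal_iff[where 'k = 'k] by blast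

end
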